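(* Let $n,p\in\mathbb N$ with $p\ge n$, let $\mu=\{t_i\}_{i=0,\dots,p+n+1}$, $t_i\le t_{i+1}$, be a knot partition, let $\mathbf z_0,\dots,\mathbf z_p\in\mathbb C$, and let $\mathbf z(t)=\sum_{i=0}^p \mathbf z_i N^n_{i,\mu}(t)$, $t\in[t_n,t_{p+1}]$. Let $q=(n+1)(p+n)$ and let $\nu=\{s_i\}_{i=0,\dots,(p+n+2)(n+1)-1}=\{\langle t_i\rangle^{n+1}\}_{i=0,\dots,p+n+1}$. Then: (i) The functions $N^{2n}_{k,\nu}$, $k=0,\dots,q$, are linearly independent, so the Gramian matrix $A=(a_{k,l})_{k,l=0,\dots,q}$, $a_{k,l}=\int_{t_0}^{t_{p+n+1}}N^{2n}_{k,\nu}(t)N^{2n}_{l,\nu}(t)\,dt$, is nonsingular. For all $0\le i,j\le p$, the coefficients $\chi^{i,j}=(\chi^{i,j}_0,\dots,\chi^{i,j}_q)^T$ in $N^n_{i,\mu}(t)N^n_{j,\mu}(t)=\sum_{k=0}^q\chi^{i,j}_kN^{2n}_{k,\nu}(t)$ are obtained as the unique solution of the linear system $A\chi^{i,j}=b^{i,j}$, where $b^{i,j}=(b^{i,j}_l)_{l=0,\dots,q}$, $b^{i,j}_l=\int_{t_0}^{t_{p+n+1}}N^n_{i,\mu}(t)N^n_{j,\mu}(t)N^{2n}_{l,\nu}(t)\,dt$. (ii) $\mathbf p(t)=\mathbf z^2(t)=\sum_{k=0}^q\mathbf p_kN^{2n}_{k,\nu}(t)$ with $\mathbf p_k=\sum_{i=0}^p\sum_{j=0}^p\chi^{i,j}_k\mathbf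 z_i\mathbf z_j$, $k=0,\dots,q$. (iii) The Pythagorean-Hodograph B-spline curve obtained by integrating $\mathbf p$ is $$\mathbf r(t)=\int\mathbf p(t)\,dt=\sum_{i=0}^{q+1}\mathbf r_iN^{2n+1}_{i,\rho}(t),\qquad t\in[t_n,t_{p+1}],$$ where $\rho=\{t_{-1},\{\langle t_k\rangle^{n+1}\}_{k=0,\dots,p+n+1},t_{p+n+2}\}$ with additional knots $t_{-1}\le t_0$ and $t_{p+n+2}\ge t_{p+n+1}$, $\mathbf r_0$ is arbitrary, and $\mathbf r_{i+1}=\mathbf r_i+\frac{s_{i+2n+1}-s_i}{2n+1}\mathbf p_i$ for $i=0,\dots,q$.
   Context: Normalized B-splines: for a nondecreasing knot sequence $\mu=\{t_i\}$, $N^0_{i,\mu}(t)=1$ if $t\in[t_i,t_{i+1})$ and $0$ otherwise, and $N^n_{i,\mu}(t)=\frac{t-t_i}{t_{i+n}-t_i}N^{n-1}_{i,\mu}(t)+\frac{t_{i+n+1}-t}{t_{i+n+1}-t_{i+1}}N^{n-1}_{i+1,\mu}(t)$ with the convention $0/0=0$. Basis functions are indexed by the position (starting at $0$) of their first knot in the partition. $\langle t\rangle^k$ denotes the knot $t$ repeated $k$ times. Points of $\mathbb R^2$ are identified with complex numbers. A (primitive, planar) Pythagorean-Hodograph B-spline curve of degree $2n+1$ is a curve $\mathbf r$ with hodograph $\mathbf r'=\mathbf z^2=(u^2-v^2)+2\mathrm i uv$, where $\mathbf z=u+\mathrm i v$ and $u,v$ are degree-$n$ spline functions over $\mu$ (non-constant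 and without a non-constant spline function over $\mu$ as common factor).
   Formalization: Independence, nonsingularity and uniqueness in (i) are claimed only for strictly increasing knots, since they fail whenever two knots coincide; in (iii) the right endpoint is excluded when t_{p+1}=t_{p+n+2}, where all the half-open B-splines vanish. *)

theory Defs
  imports "HOL-Analysis.Analysis" "Jordan_Normal_Form.Matrix"
begin

text \<open>
  Knot sequences are functions \<^typ>\<open>nat \<Rightarrow> real\<close>; only finitely many of their values are relevant.
  The convention \<open>0/0 = 0\<close> in the recursion agrees with division in HOL: whenever one of the
  denominators vanishes, HOL's \<open>x/0 = 0\<close> discards the corresponding term.
\<close>

fun bspline :: "(nat \<Rightarrow> real) \<Rightarrow> nat \<Rightarrow> nat \<Rightarrow> real \<Rightarrow> real" where
  "bspline t 0 i x = (if t i \<le> x \<and> x < t (i + 1) then 1 else 0)"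
| "bspline t (Suc n) i x =
     (x - t i) / (t (i + Suc n) - t i) * bspline t n i x
   + (t (i + Suc n + 1) - x) / (t (i + Suc n + 1) - t (i + 1)) * bspline t n (i + 1) x"

definition repeat_knots :: "nat \<Rightarrow> (nat \<Rightarrow> real) \<Rightarrow> nat \<Rightarrow> real" where
  "repeat_knots m t i = t (i div m)"

text \<open>
  The finite knot sequence \<open>s\<^sub>0, \<dots>, s\<^sub>N\<^sub>-\<^sub>1\<close> with \<open>a\<close> put in front and \<open>b\<close> behind; positions are counted
  from \<open>0\<close>, so \<open>a\<close> has position \<open>0\<close> and \<open>s\<^sub>i\<close> has position \<open>i + 1\<close>.
\<close>

definition extend_knots :: "real \<Rightarrow> nat \<Rightarrow> (nat \<Rightarrow> real) \<Rightarrow> real \<Rightarrow> nat \<Rightarrow> real" where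
  "extend_knots a N s b i = (if i = 0 then a else if i \<le> N then s (i - 1) else b)"

definition spline :: "(nat \<Rightarrow> real) \<Rightarrow> nat \<Rightarrow> nat \<Rightarrow> (nat \<Rightarrow> complex) \<Rightarrow> real \<Rightarrow> complex" where
  "spline t n m c x = (\<Sum>i\<le>m. bspline t n i x *\<^sub>R c i)"

definition linearly_independent_on :: "'a set \<Rightarrow> nat set \<Rightarrow> (nat \<Rightarrow> 'a \<Rightarrow> real) \<Rightarrow> bool" where
  "linearly_independent_on D K f \<longleftrightarrow>
     (\<forall>c. (\<forall>x\<in>D. (\<Sum>k\<in>K. c k * f k x) = 0) \<longrightarrow> (\<forall>k\<in>K. c k = 0))"

text \<open>
  \<open>r = \<integral>f\<close> on the interval \<open>D\<close>. The integral form is used because a spline with multiple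
  knots may have jumps, where an antiderivative need not be differentiable.
\<close>

definition indefinite_integral_on :: "real set \<Rightarrow> (real \<Rightarrow> complex) \<Rightarrow> (real \<Rightarrow> complex) \<Rightarrow> bool" where
  "indefinite_integral_on D f r \<longleftrightarrow>
     (\<forall>x\<in>D. \<forall>y\<in>D. x \<le> y \<longrightarrow> (f has_integral (r y - r x)) {x..y})"

end

theory Submission
  imports Defs "Jordan_Normal_Form.Determinant"
begin

text \<open>
  Up to sign, the tail sum \<open>N\<^sub>k + N\<^sub>k\<^sub>+\<^sub>1 + \<dots>\<close> of B-splines of degree \<open>d\<close> is the divided difference over
  \<open>t\<^sub>k, \<dots>, t\<^sub>k\<^sub>+\<^sub>d\<close> of the truncated power \<open>(x - y)\<^sub>+\<^sup>d\<close> in \<open>y\<close>. Differentiation in \<open>x\<close> lowers the exponent, so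
  summation by parts gives the integral of a spline, without any assumption on the multiplicities of
  the knots.

  A B-spline is therefore a combination of truncated powers \<open>(x - \<tau>)\<^sub>+\<^sup>n\<^sup>-\<^sup>r\<close> with \<open>r\<close> below the multiplicity
  \<open>m\<close> of the knot \<open>\<tau>\<close>, and a product of two of them is a combination of truncated powers of
  exponents \<open>2n - R\<close> with \<open>R \<le> n + r < m(n + 1)\<close>. Marsden's identity, truncated to the B-splines that start at or
  after \<open>\<tau>\<close> and expanded at \<open>\<tau>\<close>, shows that these lie in the span of the B-splines over the knots
  repeated \<open>n + 1\<close> times. Finally, a spline whose coefficients are in the kernel of the Gramian has vanishing
  \<open>L\<^sup>2\<close> norm, and vanishes everywhere because it is continuous from the right.
\<close>

subsection \<open>Truncated powers and divided differences\<close>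

text \<open>The test \<open>a \<le> x\<close> matters only for exponent 0: with
  \<open>0 ^ 0 = 1\<close> the step is then continuous from the right, like the B-splines of degree
  0.\<close>

definition trunc_pow :: "real \<Rightarrow> nat \<Rightarrow> real \<Rightarrow> real" where
  "trunc_pow a e x = (if a \<le> x then (x - a) ^ e else 0)"

lemma trunc_pow_Suc: "trunc_pow a (Suc e) x = (x - a) * trunc_pow a e x"
  by (simp add: trunc_pow_def)

text \<open>
  The divided difference over \<open>t\<^sub>k, \<dots>, t\<^sub>k\<^sub>+\<^sub>m\<close> of \<open>y \<mapsto> (x - y)\<^sub>+\<^sup>d\<close>. Its value on equal knots is the
  \<open>m\<close>-th Taylor coefficient in \<open>y\<close>, with \<open>0\<^sup>0 = 1\<close> and continuity from the right in \<open>x\<close>.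
\<close>

fun ddiff :: "(nat \<Rightarrow> real) \<Rightarrow> nat \<Rightarrow> nat \<Rightarrow> nat \<Rightarrow> real \<Rightarrow> real" where
  "ddiff t d 0 k x = trunc_pow (t k) d x"
| "ddiff t d (Suc m) k x =
     (if t k = t (k + Suc m)
      then (-1) ^ Suc m * real (d choose Suc m) * trunc_pow (t k) (d - Suc m) x
      else (ddiff t d m (k + 1) x - ddiff t d m k x) / (t (k + Suc m) - t k))"

lemma ddiff_eq_knots:
  assumes "t k = t (k + m)"
  shows "ddiff t d m k x = (-1) ^ m * real (d choose m) * trunc_pow (t k) (d - m) x"
  using assms by (cases m) auto

lemma mono_eq_knots:
  fixes t :: "nat \<Rightarrow> real"
  assumes "mono t" "t a = t b" "a \<le> i" "i \<le> b"
  shows "t i = t a"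
  using monoD[OF assms(1,3)] monoD[OF assms(1,4)] assms(2) by simp

text \<open>Leibniz' rule for \<open>(x - y)\<^sub>+\<^sup>d\<^sup>+\<^sup>1 = (x - y) (x - y)\<^sub>+\<^sup>d\<close>.\<close>

lemma ddiff_leibniz:
  assumes "mono t"
  shows "ddiff t (Suc d) (Suc m) k x = (x - t k) * ddiff t d (Suc m) k x - ddiff t d m (k + 1) x"
proof (induction m arbitrary: k)
  case 0
  show ?case
  proof (cases "t k = t (k + 1)")
    case True
    have "real d * trunc_pow a d x = real d * ((x - a) * trunc_pow a (d - Suc 0) x)" for a
      by (cases d) (simp_all add: trunc_pow_Suc)
    from this[of "t (k + 1)"] True show ?thesis
      by (simp add: trunc_pow_Suc algebra_simps)
  next
    case False
    define h where "h = t (k + 1) - t k"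
    have h: "h \<noteq> 0" "t (k + 1) = t k + h"
      using False by (simp_all add: h_def)
    have "((x - (t k + h)) * v - (x - t k) * w) / h = (x - t k) * ((v - w) / h) - v" for v w
      using h(1) by (simp add: field_simps)
    then show ?thesis
      using h by (simp add: trunc_pow_Suc)
  qed
next
  case (Suc m)
  show ?case
  proof (cases "t k = t (k + Suc (Suc m))")
    case True
    have e: "t (k + 1) = t k" "t (k + 1 + Suc m) = t k"
      using mono_eq_knots[OF assms True, of "k+1"] True by simp_all
    have 1: "ddiff t d (Suc m) (k + 1) x
        = (-1) ^ Suc m * real (d choose Suc m) * trunc_pow (t k) (d - Suc m) x"
      using ddiff_eq_knots[of t "k+1" "Suc m" d x] e by simp
    have 2: "ddiff t (Suc d) (Suc (Suc m)) k x
        = (-1) ^ Suc (Suc m) * real (Suc d choose Suc (Suc m)) * trunc_pow (t k) (d - Suc m) x"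
      using ddiff_eq_knots[OF True, of "Suc d" x] by simp
    have 3: "ddiff t d (Suc (Suc m)) k x
        = (-1) ^ Suc (Suc m) * real (d choose Suc (Suc m)) * trunc_pow (t k) (d - Suc (Suc m)) x"
      using ddiff_eq_knots[OF True, of d x] by simp
    \<comment> \<open>If \<open>Suc (Suc m)\<close> exceeds \<open>d\<close>, the binomial
      coefficient is 0, so the cut-off subtraction in the exponents is harmless.\<close>
    have 4: "(x - t k) * (real (d choose Suc (Suc m)) * trunc_pow (t k) (d - Suc (Suc m)) x)
        = real (d choose Suc (Suc m)) * trunc_pow (t k) (d - Suc m) x"
    proof (cases "Suc (Suc m) \<le> d")
      case le: True
      then have "d - Suc m = Suc (d - Suc (Suc m))"
        by simp
      then show ?thesis
        by (simp add: trunc_pow_Suc)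
    qed simp
    have "(x - t k) * ddiff t d (Suc (Suc m)) k x
        = (-1) ^ Suc (Suc m) * (real (d choose Suc (Suc m)) * trunc_pow (t k) (d - Suc m) x)"
      unfolding 3 using 4 by (simp add: mult.left_commute)
    \<comment> \<open>Pascal's rule for \<open>Suc d choose Suc (Suc m)\<close>.\<close>
    then show ?thesis
      unfolding 1 2 by (simp add: algebra_simps)
  next
    case False
    define h where "h = t (k + Suc (Suc m)) - t k"
    have h: "h \<noteq> 0"
      using False by (simp add: h_def)
    define A where "A = ddiff t d (Suc m) (k + 1) x"
    define B where "B = ddiff t d (Suc m) k x"
    have "ddiff t (Suc d) (Suc (Suc m)) k x
        = (ddiff t (Suc d) (Suc m) (k + 1) x - ddiff t (Suc d) (Suc m) k x) / h"
      using False by (simp add: h_def)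
    also have "ddiff t (Suc d) (Suc m) (k + 1) x = (x - t (k + Suc (Suc m))) * A - ddiff t d m (k + 2) x
        + (t (k + Suc (Suc m)) - t (k + 1)) * A"
      unfolding Suc.IH A_def by (simp add: algebra_simps)
    \<comment> \<open>This is the recursion defining \<open>A\<close>, multiplied by its
      denominator. If the denominator is 0, the two terms on the right are the same Taylor
      coefficient.\<close>
    also have "(t (k + Suc (Suc m)) - t (k + 1)) * A = ddiff t d m (k + 2) x - ddiff t d m (k + 1) x"
    proof (cases "t (k + 1) = t (k + Suc (Suc m))")
      case True
      have "t (k + 2) = t (k + 1)" "t (k + 1 + m) = t (k + 1)" "t (k + 2 + m) = t (k + 1)"
        using True mono_eq_knots[OF assms True, of "k+2"] mono_eq_knots[OF assms True, of "k+1+m"] by simp_all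
      then show ?thesis
        using True ddiff_eq_knots[of t "k+2" m d x] ddiff_eq_knots[of t "k+1" m d x] by simp
    next
      case False
      then show ?thesis
        unfolding A_def by (simp add: numeral_2_eq_2)
    qed
    also have "ddiff t (Suc d) (Suc m) k x = (x - t k) * B - ddiff t d m (k + 1) x"
      unfolding Suc.IH B_def by simp
    also have "((x - t (k + Suc (Suc m))) * A - ddiff t d m (k + 2) x
          + (ddiff t d m (k + 2) x - ddiff t d m (k + 1) x) - ((x - t k) * B - ddiff t d m (k + 1) x)) / h
        = (x - t k) * ((A - B) / h) - A"
    proof -
      have "((x - (a + h)) * A - C + (C - D) - ((x - a) * B - D)) / h = (x - a) * ((A - B) / h) - A" for a C D
        using h by (simp add: field_simps)
      moreover have "t (k + Suc (Suc m)) = t k + h"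
        by (simp add: h_def)
      ultimately show ?thesis
        by metis
    qed
    also have "(A - B) / h = ddiff t d (Suc (Suc m)) k x"
      using False by (simp add: A_def B_def h_def)
    finally show ?thesis
      by (simp add: A_def)
  qed
qed

text \<open>
  The tail sum of the B-splines of degree \<open>d\<close> from index \<open>k\<close> on; it rises from \<open>0\<close> at \<open>t\<^sub>k\<close> to \<open>1\<close> at
  \<open>t\<^sub>k\<^sub>+\<^sub>d\<close>.
\<close>

definition bstep :: "(nat \<Rightarrow> real) \<Rightarrow> nat \<Rightarrow> nat \<Rightarrow> real \<Rightarrow> real" where
  "bstep t d k x = (-1) ^ d * ddiff t d d k x"

lemma ddiff_eq_bstep: "ddiff t d d k x = (-1) ^ d * bstep t d k x"
  by (cases "even d") (simp_all add: bstep_def)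

lemma bstep_0: "bstep t 0 k x = (if t k \<le> x then 1 else 0)"
  by (simp add: bstep_def trunc_pow_def)

text \<open>Leibniz' rule with order equal to degree. If all the knots involved coincide, the
  fraction is 0 by convention, and both \<open>bstep t (Suc d) k\<close> and
  \<open>bstep t d (k + 1)\<close> are the unit jump at \<open>t k\<close>.\<close>

lemma bstep_Suc:
  assumes "mono t"
  shows "bstep t (Suc d) k x
    = bstep t d (k + 1) x + (x - t k) / (t (k + Suc d) - t k) * (bstep t d k x - bstep t d (k + 1) x)"
proof (cases "t k = t (k + Suc d)")
  case True
  have e: "t (k + 1) = t k" "t (k + 1) = t (k + 1 + d)"
    using mono_eq_knots[OF assms True, of "k+1"] True by simp_all
  have "bstep t (Suc d) k x = trunc_pow (t k) 0 x"
    using True by (cases "even d") (simp_all add: bstep_def)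
  moreover have "bstep t d (k + 1) x = trunc_pow (t k) 0 x"
    using ddiff_eq_knots[OF e(2), of d x] e(1) by (cases "even d") (simp_all add: bstep_def)
  ultimately show ?thesis
    using True by simp
next
  case False
  define h where "h = t (k + Suc d) - t k"
  have "ddiff t (Suc d) (Suc d) k x = (x - t k) * ((ddiff t d d (k + 1) x - ddiff t d d k x) / h) - ddiff t d d (k + 1) x"
    unfolding ddiff_leibniz[OF assms] using False by (simp add: h_def)
  also have "\<dots> = (-1) ^ d * ((x - t k) / h * (bstep t d (k + 1) x - bstep t d k x) - bstep t d (k + 1) x)"
    unfolding ddiff_eq_bstep by (simp add: algebra_simps diff_divide_distrib)
  finally have 1: "ddiff t (Suc d) (Suc d) k x = \<dots>" .
  have "bstep t (Suc d) k x = - ((x - t k) / h * (bstep t d (k + 1) x - bstep t d k x) - bstep t d (k + 1) x)"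
    unfolding bstep_def[of t "Suc d"] 1 by (cases "even d") simp_all
  then show ?thesis
    unfolding h_def[symmetric] by (simp add: right_diff_distrib)
qed

text \<open>This justifies rewriting a weight whose denominator vanishes: the B-spline that it
  multiplies is 0.\<close>

lemma bspline_empty:
  assumes "mono t" "t k = t (k + Suc d)"
  shows "bspline t d k x = 0"
  using assms(2)
proof (induction d arbitrary: k)
  case (Suc d)
  have e: "t (k + 1) = t k" "t (k + Suc d) = t k"
    by (rule mono_eq_knots[OF assms(1) Suc.prems]; simp)+
  have 1: "bspline t d k x = 0"
    by (rule Suc.IH) (rule e(2)[symmetric])
  have "k + Suc (Suc d) = k + 1 + Suc d"
    by simp
  then have 2: "bspline t d (k + 1) x = 0"
    using e(1) Suc.prems by (intro Suc.IH) metis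
  show ?case
    using 1 2 by simp
qed auto

text \<open>The second weight of the B-spline recursion is one minus the first weight of the next
  index, so the recursion is the difference of two consecutive instances of
  \<open>bstep_Suc\<close>.\<close>

lemma bspline_eq_bstep_diff:
  assumes "mono t"
  shows "bspline t d k x = bstep t d k x - bstep t d (k + 1) x"
proof (induction d arbitrary: k)
  case 0
  show ?case
    using monoD[OF assms, of k "k+1"] by (auto simp: bstep_0)
next
  case (Suc d)
  have "(t (k + Suc d + 1) - x) / (t (k + Suc d + 1) - t (k + 1)) * bspline t d (k + 1) x
      = (1 - (x - t (k + 1)) / (t (k + 1 + Suc d) - t (k + 1))) * bspline t d (k + 1) x"
  proof (cases "t (k + 1) = t (k + 1 + Suc d)")
    case True
    then show ?thesis
      using bspline_empty[OF assms True] by simp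
  next
    case False
    then show ?thesis
      by (simp add: field_simps)
  qed
  then show ?case
    unfolding bspline.simps bstep_Suc[OF assms] Suc.IH by (simp add: algebra_simps)
qed

lemma bstep_eq_0:
  assumes "mono t" "x \<le> t k" "x < t (k + d)"
  shows "bstep t d k x = 0"
  using assms(2,3)
proof (induction d arbitrary: k)
  case (Suc d)
  have 1: "bstep t d (k + 1) x = 0"
    using Suc.prems monoD[OF assms(1), of k "k+1"] by (intro Suc.IH) auto
  have 2: "bstep t d k x = 0" if "x < t k"
    using that monoD[OF assms(1), of k "k+d"] by (intro Suc.IH) auto
  show ?case
    unfolding bstep_Suc[OF assms(1)] 1 using 2 Suc.prems by (cases "x = t k") auto
qed (simp add: bstep_0)

lemma bstep_eq_1:
  assumes "mono t" "t (k + d) \<le> x"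
  shows "bstep t d k x = 1"
  using assms(2)
proof (induction d arbitrary: k)
  case (Suc d)
  have 1: "bstep t d (k + 1) x = 1"
    using Suc.prems by (intro Suc.IH) auto
  have 2: "bstep t d k x = 1"
    using Suc.prems monoD[OF assms(1), of "k+d" "k+Suc d"] by (intro Suc.IH) auto
  show ?case
    unfolding bstep_Suc[OF assms(1)] 1 2 by simp
qed (simp add: bstep_0)

text \<open>The classical form of a B-spline: a divided difference of order one more than the
  degree. If all knots coincide, the left side is 0 because of \<open>d choose Suc d\<close>, the
  right side by division by 0.\<close>

lemma ddiff_full:
  assumes "mono t"
  shows "ddiff t d (Suc d) k x = (-1) ^ Suc d * bspline t d k x / (t (k + Suc d) - t k)"
proof (cases "t k = t (k + Suc d)")
  case False
  then show ?thesis
    unfolding bspline_eq_bstep_diff[OF assms]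
    by (simp add: ddiff_eq_bstep algebra_simps diff_divide_distrib)
qed simp

lemma bspline_eq_0:
  assumes "mono t" "x < t k \<or> t (k + Suc d) \<le> x"
  shows "bspline t d k x = 0"
  using assms(2)
proof
  assume "x < t k"
  then show ?thesis
    unfolding bspline_eq_bstep_diff[OF assms(1)]
    using monoD[OF assms(1), of k "k+d"] monoD[OF assms(1), of k "k+1"] monoD[OF assms(1), of k "k+1+d"]
      bstep_eq_0[OF assms(1), of x k d] bstep_eq_0[OF assms(1), of x "k+1" d] by simp
next
  assume "t (k + Suc d) \<le> x"
  then show ?thesis
    unfolding bspline_eq_bstep_diff[OF assms(1)]
    using monoD[OF assms(1), of "k+d" "k+Suc d"]
      bstep_eq_1[OF assms(1), of k d x] bstep_eq_1[OF assms(1), of "k+1" d x] by simp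
qed

text \<open>Used to replace a knot sequence by one that is monotone everywhere; the separate offsets
  \<open>k\<close> and \<open>k'\<close> also cover the shift by one caused by a knot put in
  front.\<close>

lemma bspline_cong:
  assumes "\<And>i. i \<le> Suc d \<Longrightarrow> t (k + i) = t' (k' + i)"
  shows "bspline t d k x = bspline t' d k' x"
  using assms
proof (induction d arbitrary: k k')
  case 0
  then show ?case
    using 0[of 0] 0[of 1] by simp
next
  case (Suc d)
  have 1: "bspline t d k x = bspline t' d k' x"
    by (rule Suc.IH) (use Suc.prems in simp)
  have 2: "bspline t d (k + 1) x = bspline t' d (k' + 1) x"
  proof (rule Suc.IH)
    fix i assume "i \<le> Suc d"
    then show "t (k + 1 + i) = t' (k' + 1 + i)"
      using Suc.prems[of "Suc i"] by simp
  qed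
  show ?case
    using Suc.prems[of 0] Suc.prems[of 1] Suc.prems[of "Suc d"] Suc.prems[of "Suc (Suc d)"]
    by (simp add: 1 2[simplified])
qed

subsection \<open>Derivatives and integrals\<close>

lemma trunc_pow_DERIV:
  assumes "x \<noteq> a"
  shows "(trunc_pow a (Suc e) has_real_derivative real (Suc e) * trunc_pow a e x) (at x)"
proof (cases "x < a")
  case True
  have "((\<lambda>x. 0::real) has_real_derivative 0) (at x)"
    by simp
  then show ?thesis
    using True by (rule_tac has_field_derivative_transform_within_open[where S = "{..<a}" and f = "\<lambda>x. 0"])
      (auto simp: trunc_pow_def)
next
  case False
  have "((\<lambda>x. (x - a) ^ Suc e) has_real_derivative real (Suc e) * (1 * (x - a) ^ (Suc e - Suc 0))) (at x)"
    by (rule DERIV_power) (auto intro!: derivative_eq_intros)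
  then show ?thesis
    using False assms
    by (rule_tac has_field_derivative_transform_within_open[where S = "{a<..}" and f = "\<lambda>x. (x - a) ^ Suc e"])
      (auto simp: trunc_pow_def)
qed

lemma trunc_pow_0_DERIV:
  assumes "x \<noteq> a"
  shows "(trunc_pow a 0 has_real_derivative 0) (at x)"
proof (cases "x < a")
  case True
  have "((\<lambda>x. 0::real) has_real_derivative 0) (at x)"
    by simp
  then show ?thesis
    using True by (rule_tac has_field_derivative_transform_within_open[where S = "{..<a}" and f = "\<lambda>x. 0"])
      (auto simp: trunc_pow_def)
next
  case False
  have "((\<lambda>x. 1::real) has_real_derivative 0) (at x)"
    by simp
  then show ?thesis
    using False assms by (rule_tac has_field_derivative_transform_within_open[where S = "{a<..}" and f = "\<lambda>x. 1"])
      (auto simp: trunc_pow_def)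
qed

text \<open>The antiderivative may have a kink at \<open>c\<close>, so the fundamental theorem is
  used with this point excepted; continuity across it is visible from the form with
  \<open>max\<close>.\<close>

lemma trunc_pow_has_integral:
  assumes "a \<le> b"
  shows "((\<lambda>x. real (Suc e) * trunc_pow c e x) has_integral
    (trunc_pow c (Suc e) b - trunc_pow c (Suc e) a)) {a..b}"
proof (rule fundamental_theorem_of_calculus_interior_strong[where S = "{c}"])
  show "(trunc_pow c (Suc e) has_vector_derivative real (Suc e) * trunc_pow c e x) (at x)"
    if "x \<in> {a<..<b} - {c}" for x
    using that trunc_pow_DERIV[of x c e] by (simp add: has_real_derivative_iff_has_vector_derivative)
  have "trunc_pow c (Suc e) = (\<lambda>x. (max 0 (x - c)) ^ Suc e)"
    by (auto simp: trunc_pow_def fun_eq_iff max_def)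
  then show "continuous_on {a..b} (trunc_pow c (Suc e))"
    by (auto intro!: continuous_intros)
qed (use assms in auto)

text \<open>On equal knots, differentiation brings down the exponent \<open>Suc d - m\<close>; this
  turns it into the factor \<open>Suc d\<close> common to all divided differences.\<close>

lemma Suc_choose_absorb: "real (Suc d - m) * real (Suc d choose m) = real (Suc d) * real (d choose m)"
  using binomial_absorb_comp[of "Suc d" m] by (simp flip: of_nat_mult del: of_nat_Suc)

text \<open>Differentiation in \<open>x\<close> commutes with the divided difference in the knots
  and so reduces to the truncated powers, which are smooth away from their knots.\<close>

lemma ddiff_DERIV:
  assumes "\<And>i. k \<le> i \<Longrightarrow> i \<le> k + m \<Longrightarrow> t i \<noteq> x"
  shows "(ddiff t (Suc d) m k has_real_derivative real (Suc d) * ddiff t d m k x) (at x)"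
  using assms
proof (induction m arbitrary: k)
  case 0
  have "ddiff t (Suc d) 0 k = trunc_pow (t k) (Suc d)"
    by (simp add: fun_eq_iff)
  then show ?case
    using trunc_pow_DERIV[of x "t k" d] 0[of k] by auto
next
  case (Suc m)
  show ?case
  proof (cases "t k = t (k + Suc m)")
    case True
    define c where "c = (-1) ^ Suc m * real (Suc d choose Suc m)"
    have eq: "ddiff t (Suc d) (Suc m) k = (\<lambda>x. c * trunc_pow (t k) (Suc d - Suc m) x)"
      using ddiff_eq_knots[OF True, of "Suc d"] by (simp add: fun_eq_iff c_def)
    have x: "x \<noteq> t k"
      using Suc.prems[of k] by auto
    show ?thesis
    proof (cases "Suc m \<le> d")
      case le: True
      have e: "Suc d - Suc m = Suc (d - Suc m)"
        using le by simp
      have "((\<lambda>x. c * trunc_pow (t k) (Suc d - Suc m) x) has_real_derivative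
          c * (real (Suc d - Suc m) * trunc_pow (t k) (d - Suc m) x)) (at x)"
        unfolding e by (rule DERIV_cmult[OF trunc_pow_DERIV[OF x]])
      moreover have "c * (real (Suc d - Suc m) * trunc_pow (t k) (d - Suc m) x)
          = real (Suc d) * ddiff t d (Suc m) k x"
      proof -
        have "c * real (Suc d - Suc m) = real (Suc d) * ((-1) ^ Suc m * real (d choose Suc m))"
          unfolding c_def using Suc_choose_absorb[of d "Suc m"] by (simp add: algebra_simps del: binomial_Suc_Suc of_nat_Suc)
        then show ?thesis
          unfolding ddiff_eq_knots[OF True] by (simp only: mult.assoc[symmetric])
      qed
      ultimately show ?thesis
        unfolding eq by simp
    next
      case nle: False
      \<comment> \<open>The exponent is 0 here: the function is locally constant off the knot, in
        agreement with \<open>d choose Suc m = 0\<close>.\<close>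
      then have "((\<lambda>x. c * trunc_pow (t k) (Suc d - Suc m) x) has_real_derivative c * 0) (at x)"
        using DERIV_cmult[OF trunc_pow_0_DERIV[OF x]] by simp
      then show ?thesis
        unfolding eq ddiff_eq_knots[OF True] using nle by (simp add: binomial_eq_0)
    qed
  next
    case False
    have "((\<lambda>x. (ddiff t (Suc d) m (k + 1) x - ddiff t (Suc d) m k x) / (t (k + Suc m) - t k)) has_real_derivative
       (real (Suc d) * ddiff t d m (k + 1) x - real (Suc d) * ddiff t d m k x) / (t (k + Suc m) - t k)) (at x)"
      by (intro DERIV_cdivide DERIV_diff Suc.IH Suc.prems) auto
    moreover have "ddiff t (Suc d) (Suc m) k
        = (\<lambda>x. (ddiff t (Suc d) m (k + 1) x - ddiff t (Suc d) m k x) / (t (k + Suc m) - t k))"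
      using False by (simp add: fun_eq_iff)
    moreover have "real (Suc d) * ddiff t d (Suc m) k x
        = (real (Suc d) * ddiff t d m (k + 1) x - real (Suc d) * ddiff t d m k x) / (t (k + Suc m) - t k)"
      using False by (simp add: right_diff_distrib)
    ultimately show ?thesis
      by simp
  qed
qed

text \<open>The bound \<open>m \<le> d\<close> keeps every exponent in the antiderivative positive,
  so the antiderivative is continuous and the interval may contain knots.\<close>

lemma ddiff_has_integral:
  assumes "a \<le> b" "m \<le> d"
  shows "((\<lambda>x. real (Suc d) * ddiff t d m k x) has_integral
    (ddiff t (Suc d) m k b - ddiff t (Suc d) m k a)) {a..b}"
  using assms(2)
proof (induction m arbitrary: k)
  case 0
  show ?case
    using trunc_pow_has_integral[OF assms(1)] by simp
next
  case (Suc m)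
  show ?case
  proof (cases "t k = t (k + Suc m)")
    case True
    define c where "c = (-1) ^ Suc m * real (Suc d choose Suc m)"
    have e: "Suc d - Suc m = Suc (d - Suc m)"
      using Suc.prems by simp
    have eq: "ddiff t (Suc d) (Suc m) k x = c * trunc_pow (t k) (Suc (d - Suc m)) x" for x
      unfolding ddiff_eq_knots[OF True] c_def e ..
    have "c * real (Suc d - Suc m) = real (Suc d) * ((-1) ^ Suc m * real (d choose Suc m))"
      unfolding c_def using Suc_choose_absorb[of d "Suc m"]
      by (simp add: algebra_simps del: binomial_Suc_Suc of_nat_Suc)
    then have eq': "real (Suc d) * ddiff t d (Suc m) k x
        = c * (real (Suc (d - Suc m)) * trunc_pow (t k) (d - Suc m) x)" for x
      unfolding ddiff_eq_knots[OF True] e by (simp only: mult.assoc[symmetric])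
    show ?thesis
      unfolding eq eq' right_diff_distrib[symmetric]
      by (rule has_integral_mult_right[OF trunc_pow_has_integral[OF assms(1)]])
  next
    case False
    have "((\<lambda>x. (real (Suc d) * ddiff t d m (k + 1) x - real (Suc d) * ddiff t d m k x) / (t (k + Suc m) - t k))
      has_integral
       ((ddiff t (Suc d) m (k + 1) b - ddiff t (Suc d) m (k + 1) a)
         - (ddiff t (Suc d) m k b - ddiff t (Suc d) m k a)) / (t (k + Suc m) - t k)) {a..b}"
      using Suc.prems by (intro has_integral_divide has_integral_diff Suc.IH) auto
    moreover have "real (Suc d) * ddiff t d (Suc m) k x
        = (real (Suc d) * ddiff t d m (k + 1) x - real (Suc d) * ddiff t d m k x) / (t (k + Suc m) - t k)" for x
      using False by (simp add: right_diff_distrib)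
    moreover have "ddiff t (Suc d) (Suc m) k b - ddiff t (Suc d) (Suc m) k a
        = ((ddiff t (Suc d) m (k + 1) b - ddiff t (Suc d) m (k + 1) a)
         - (ddiff t (Suc d) m k b - ddiff t (Suc d) m k a)) / (t (k + Suc m) - t k)"
      using False by (simp add: diff_divide_distrib)
    ultimately show ?thesis
      by simp
  qed
qed

lemma bstep_DERIV:
  assumes "mono t" "\<And>i. k \<le> i \<Longrightarrow> i \<le> k + Suc d \<Longrightarrow> t i \<noteq> x"
  shows "(bstep t (Suc d) k has_real_derivative
    real (Suc d) / (t (k + Suc d) - t k) * bspline t d k x) (at x)"
proof -
  have "((\<lambda>x. (-1) ^ Suc d * ddiff t (Suc d) (Suc d) k x) has_real_derivative
      (-1) ^ Suc d * (real (Suc d) * ddiff t d (Suc d) k x)) (at x)"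
    by (intro DERIV_cmult ddiff_DERIV assms)
  moreover have "(-1) ^ Suc d * (real (Suc d) * ddiff t d (Suc d) k x)
      = real (Suc d) / (t (k + Suc d) - t k) * bspline t d k x"
    unfolding ddiff_full[OF assms(1)] by (cases "even d") simp_all
  ultimately show ?thesis
    unfolding bstep_def[abs_def] by simp
qed

text \<open>If \<open>t k = t (k + Suc d)\<close>, then the step has a jump, but both sides are \<open>0\<close>.\<close>

lemma bspline_has_integral:
  assumes "mono t" "a \<le> b"
  shows "(bspline t d k has_integral
    (t (k + Suc d) - t k) / real (Suc d) * (bstep t (Suc d) k b - bstep t (Suc d) k a)) {a..b}"
proof (cases "t k = t (k + Suc d)")
  case True
  then show ?thesis
    using bspline_empty[OF assms(1) True] has_integral_0[of "{a..b}"] by (simp add: fun_eq_iff[symmetric] cong: has_integral_cong)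
next
  case False
  define h where "h = t (k + Suc d) - t k"
  have h: "h \<noteq> 0"
    using False by (simp add: h_def)
  \<comment> \<open>The step of degree \<open>Suc d\<close> has order \<open>Suc d\<close>, beyond
    the range of \<open>ddiff_has_integral\<close>; since \<open>h\<close> is nonzero, it is a
    quotient of the difference \<open>F\<close> of two terms of order \<open>d\<close>, which are in
    range.\<close>
  define F where "F x = ddiff t (Suc d) d (k + 1) x - ddiff t (Suc d) d k x" for x
  have "((\<lambda>x. (real (Suc d) * ddiff t d d (k + 1) x - real (Suc d) * ddiff t d d k x) * ((-1) ^ Suc d / real (Suc d)))
      has_integral ((ddiff t (Suc d) d (k + 1) b - ddiff t (Suc d) d (k + 1) a)
         - (ddiff t (Suc d) d k b - ddiff t (Suc d) d k a)) * ((-1) ^ Suc d / real (Suc d))) {a..b}"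
    by (intro has_integral_mult_left has_integral_diff ddiff_has_integral assms) auto
  moreover have "(real (Suc d) * ddiff t d d (k + 1) x - real (Suc d) * ddiff t d d k x) * ((-1) ^ Suc d / real (Suc d))
      = bspline t d k x" for x
  proof -
    have cancel: "(n * v - n * w) * (s / n) = (v - w) * s" if "n \<noteq> 0" for n v w s :: real
      using that by (simp add: field_simps)
    show ?thesis
      unfolding bspline_eq_bstep_diff[OF assms(1)] ddiff_eq_bstep
      by (subst cancel, simp, cases "even d") simp_all
  qed
  moreover have "((ddiff t (Suc d) d (k + 1) b - ddiff t (Suc d) d (k + 1) a)
         - (ddiff t (Suc d) d k b - ddiff t (Suc d) d k a)) * ((-1) ^ Suc d / real (Suc d))
      = h / real (Suc d) * (bstep t (Suc d) k b - bstep t (Suc d) k a)"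
  proof -
    have B: "bstep t (Suc d) k x = (-1) ^ Suc d * (F x / h)" for x
      unfolding bstep_def F_def h_def using False by simp
    have F: "(ddiff t (Suc d) d (k + 1) b - ddiff t (Suc d) d (k + 1) a)
         - (ddiff t (Suc d) d k b - ddiff t (Suc d) d k a) = F b - F a"
      by (simp add: F_def)
    have "((F b - F a) * (s / n)) = h / n * (s * (F b / h) - s * (F a / h))" for n s :: real
      using h by (cases "n = 0") (simp_all add: field_simps)
    then show ?thesis
      unfolding B F .
  qed
  ultimately show ?thesis
    by (simp add: h_def)
qed

subsection \<open>Linear independence and regularity\<close>

lemma bspline_sum_by_parts:
  fixes c :: "nat \<Rightarrow> 'a :: real_vector"
  assumes "mono t"
  shows "(\<Sum>k\<le>j. bspline t d k x *\<^sub>R c k)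
    = bstep t d 0 x *\<^sub>R c 0 + (\<Sum>k<j. bstep t d (Suc k) x *\<^sub>R (c (Suc k) - c k)) - bstep t d (Suc j) x *\<^sub>R c j"
  by (induction j) (simp_all add: bspline_eq_bstep_diff[OF assms] algebra_simps)

text \<open>On a nonempty knot interval, write the sum in steps and differentiate: the degree drops
  by one and the coefficients become positive multiples of the increments \<open>e i\<close>, for
  those \<open>i\<close> whose B-splines meet the interval. By induction these increments vanish.
  All other steps have already reached 1, so the sum is a sum of increments that telescopes to
  \<open>c k\<close>.\<close>

lemma bspline_local_independent:
  assumes "mono t" "t j < t (Suc j)"
    and "\<And>x. t j < x \<Longrightarrow> x < t (Suc j) \<Longrightarrow> (\<Sum>i\<le>j. c i * bspline t d i x) = 0"
    and "k \<le> j" "j \<le> k + d"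
  shows "c k = 0"
  using assms(3-)
proof (induction d arbitrary: c k)
  case 0
  define x where "x = (t j + t (Suc j)) / 2"
  have x: "t j < x" "x < t (Suc j)"
    using assms(2) by (simp_all add: x_def)
  have "bspline t 0 i x = 0" if "i < j" for i
    using that x monoD[OF assms(1), of "i+1" j] by auto
  then have "(\<Sum>i\<le>j. c i * bspline t 0 i x) = c j"
    using x by (simp add: lessThan_Suc_atMost[symmetric])
  then show ?case
    using 0 x by auto
next
  case (Suc d)
  \<comment> \<open>The coefficients with respect to the steps; the derivative of the sum involves only these.\<close>
  define e where "e i = (case i of 0 \<Rightarrow> c 0 | Suc i' \<Rightarrow> c i - c i')" for i
  have sum_e: "(\<Sum>i\<le>m. e i) = c m" for m
    by (induction m) (simp_all add: e_def)
  have f: "(\<Sum>i\<le>j. c i * bspline t (Suc d) i x) = (\<Sum>i\<le>j. e i * bstep t (Suc d) i x)" if "x < t (Suc j)" for x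
  proof -
    have "bstep t (Suc d) (Suc j) x = 0"
      using that monoD[OF assms(1), of "Suc j" "Suc j + Suc d"] by (intro bstep_eq_0[OF assms(1)]) auto
    then show ?thesis
      using bspline_sum_by_parts[OF assms(1), where c = c and j = j and d = "Suc d" and x = x]
      by (simp add: lessThan_Suc_atMost[symmetric] sum.lessThan_Suc_shift e_def mult.commute del: sum.lessThan_Suc)
  qed
  have "e i * (real (Suc d) / (t (i + Suc d) - t i)) = 0" if i: "i \<le> j" "j \<le> i + d" for i
  proof (rule Suc.IH[OF _ i])
    fix x assume x: "t j < x" "x < t (Suc j)"
    have ne: "t i \<noteq> x" for i
      using x monoD[OF assms(1), of i j] monoD[OF assms(1), of "Suc j" i] by (cases "i \<le> j") auto
    have "((\<lambda>x. \<Sum>i\<le>j. e i * bstep t (Suc d) i x) has_real_derivative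
        (\<Sum>i\<le>j. e i * (real (Suc d) / (t (i + Suc d) - t i) * bspline t d i x))) (at x)"
      by (intro DERIV_sum DERIV_cmult bstep_DERIV assms ne)
    moreover have "((\<lambda>x. \<Sum>i\<le>j. e i * bstep t (Suc d) i x) has_real_derivative 0) (at x)"
    proof (rule has_field_derivative_transform_within_open[where S = "{t j<..<t (Suc j)}" and f = "\<lambda>x. 0"])
      show "0 = (\<Sum>i\<le>j. e i * bstep t (Suc d) i y)" if "y \<in> {t j<..<t (Suc j)}" for y
        using that f[of y] Suc.prems(1)[of y] by simp
    qed (use x in auto)
    ultimately show "(\<Sum>i\<le>j. e i * (real (Suc d) / (t (i + Suc d) - t i)) * bspline t d i x) = 0"
      by (simp only: mult.assoc) (rule DERIV_unique)
  qed
  then have e0: "e i = 0" if "i \<le> j" "j \<le> i + d" for i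
  proof -
    have "t (i + Suc d) - t i > 0"
      using that assms(2) monoD[OF assms(1), of i j] monoD[OF assms(1), of "Suc j" "i + Suc d"] by simp
    with \<open>\<And>i. \<lbrakk>i \<le> j; j \<le> i + d\<rbrakk> \<Longrightarrow> _ i = 0\<close>[OF that] show ?thesis
      by simp
  qed
  define x where "x = (t j + t (Suc j)) / 2"
  have x: "t j < x" "x < t (Suc j)"
    using assms(2) by (simp_all add: x_def)
  have "0 = (\<Sum>i\<le>j. e i * bstep t (Suc d) i x)"
    using f[of x] Suc.prems(1)[of x] x by simp
  also have "\<dots> = (\<Sum>i\<le>j. e i)"
  proof (intro sum.cong refl)
    fix i assume i: "i \<in> {..j}"
    show "e i * bstep t (Suc d) i x = e i"
    proof (cases "j \<le> i + d")
      case True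
      then show ?thesis
        using e0 i by simp
    next
      case False
      then have "t (i + Suc d) \<le> x"
        using x monoD[OF assms(1), of "i + Suc d" j] by simp
      then show ?thesis
        using bstep_eq_1[OF assms(1)] by simp
    qed
  qed
  \<comment> \<open>For \<open>i > k\<close>, the premise \<open>j \<le> k + Suc d\<close> gives
    \<open>j \<le> i + d\<close>, so \<open>e i\<close> is among the increments known to
    vanish.\<close>
  also have "\<dots> = (\<Sum>i\<le>k. e i)"
    using Suc.prems(2,3) e0 by (intro sum.mono_neutral_right) auto
  finally show ?case
    by (simp add: sum_e)
qed

lemma bspline_continuous_at_right: "continuous (at_right x) (bspline t d k)"
proof (induction d arbitrary: k)
  case 0
  have "\<exists>b>x. \<forall>y>x. y < b \<longrightarrow> bspline t 0 k y = bspline t 0 k x"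
  proof -
    consider "x < t k" | "t k \<le> x" "x < t (k + 1)" | "t k \<le> x" "t (k + 1) \<le> x"
      by linarith
    then show ?thesis
    proof cases
      case 1
      then show ?thesis
        by (intro exI[of _ "t k"]) auto
    next
      case 2
      then show ?thesis
        by (intro exI[of _ "t (k + 1)"]) auto
    next
      case 3
      then show ?thesis
        by (intro exI[of _ "x + 1"]) auto
    qed
  qed
  then have "eventually (\<lambda>y. bspline t 0 k y = bspline t 0 k x) (at_right x)"
    unfolding eventually_at_right_field .
  then show ?case
    unfolding continuous_within by (rule tendsto_eventually)
next
  case (Suc d)
  show ?case
    unfolding bspline.simps[abs_def] divide_inverse
    by (intro continuous_intros Suc.IH)
qed

lemma bspline_measurable [measurable]: "bspline t d k \<in> borel_measurable borel"
proof (induction d arbitrary: k)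
  case 0
  show ?case
    unfolding bspline.simps[abs_def] by measurable
next
  case (Suc d)
  note [measurable] = Suc.IH
  show ?case
    unfolding bspline.simps[abs_def] by measurable
qed

lemma bspline_bounded_Icc: "\<exists>B. \<forall>x\<in>{a..b}. \<bar>bspline t d k x\<bar> \<le> B"
proof (induction d arbitrary: k)
  case 0
  show ?case
    by (intro exI[of _ 1]) auto
next
  case (Suc d)
  obtain B B' where B: "\<forall>x\<in>{a..b}. \<bar>bspline t d k x\<bar> \<le> B"
    and B': "\<forall>x\<in>{a..b}. \<bar>bspline t d (k + 1) x\<bar> \<le> B'"
    using Suc.IH[of k] Suc.IH[of "k+1"] by auto
  define C where "C = (\<bar>a\<bar> + \<bar>b\<bar> + \<bar>t k\<bar>) / \<bar>t (k + Suc d) - t k\<bar>"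
  define C' where "C' = (\<bar>a\<bar> + \<bar>b\<bar> + \<bar>t (k + Suc d + 1)\<bar>) / \<bar>t (k + Suc d + 1) - t (k + 1)\<bar>"
  show ?case
  proof (intro exI ballI)
    fix x assume x: "x \<in> {a..b}"
    have "\<bar>(x - t k) / (t (k + Suc d) - t k)\<bar> \<le> C"
      unfolding C_def abs_divide using x by (intro divide_right_mono) auto
    moreover have "\<bar>(t (k + Suc d + 1) - x) / (t (k + Suc d + 1) - t (k + 1))\<bar> \<le> C'"
      unfolding C'_def abs_divide using x by (intro divide_right_mono) auto
    ultimately show "\<bar>bspline t (Suc d) k x\<bar> \<le> C * B + C' * B'"
      unfolding bspline.simps using B B' x
      by (intro order_trans[OF abs_triangle_ineq] add_mono)
        (simp_all only: abs_mult, (rule mult_mono; fastforce intro: order_trans[OF abs_ge_zero])+)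
  qed
qed

lemma bounded_measurable_integrable_on:
  fixes f :: "real \<Rightarrow> real"
  assumes "f \<in> borel_measurable borel" "\<And>x. x \<in> {a..b} \<Longrightarrow> \<bar>f x\<bar> \<le> B"
  shows "f integrable_on {a..b}"
proof (rule measurable_bounded_by_integrable_imp_integrable[where g = "\<lambda>_. B"])
  show "f \<in> borel_measurable (lebesgue_on {a..b})"
    using assms(1) by (simp add: measurable_completion measurable_restrict_space1)
qed (use assms(2) in auto)

text \<open>A nonzero value persists to the right by one-sided continuity and contributes a positive
  amount to the integral. At \<open>b\<close> no part of the interval is left on the right.\<close>

lemma integral_square_eq_0_imp_eq_0:
  fixes g :: "real \<Rightarrow> real"
  assumes "\<And>x. continuous (at_right x) g" "(\<lambda>x. g x * g x) integrable_on {a..b}"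
    and "integral {a..b} (\<lambda>x. g x * g x) = 0" "a \<le> x" "x < b"
  shows "g x = 0"
proof (rule ccontr)
  assume "g x \<noteq> 0"
  define c where "c = g x * g x / 2"
  have c: "c > 0"
    using \<open>g x \<noteq> 0\<close> by (auto simp: c_def zero_less_mult_iff linorder_neq_iff)
  have "((\<lambda>y. g y * g y) \<longlongrightarrow> g x * g x) (at_right x)"
    using assms(1)[of x] unfolding continuous_within by (intro tendsto_intros)
  then have "eventually (\<lambda>y. c < g y * g y) (at_right x)"
    by (rule order_tendstoD) (use c in \<open>simp add: c_def\<close>)
  then obtain d where d: "d > x" "\<And>y. x < y \<Longrightarrow> y < d \<Longrightarrow> c < g y * g y"
    unfolding eventually_at_right_field by auto
  \<comment> \<open>The middle third between \<open>x\<close> and \<open>min d b\<close>, so that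
    the closed interval stays strictly inside.\<close>
  define u v where "u = x + (min d b - x) / 3" and "v = x + 2 * (min d b - x) / 3"
  have uv: "x < u" "u < v" "v < d" "v < b"
    unfolding u_def v_def using d(1) assms(5) by (auto simp: min_def field_simps)
  have sub: "{u..v} \<subseteq> {a..b}"
    using uv assms(4) by auto
  have int: "(\<lambda>y. g y * g y) integrable_on {u..v}"
    by (rule integrable_on_subinterval[OF assms(2) sub])
  have "0 < (v - u) * c"
    using uv c by simp
  also have "\<dots> = integral {u..v} (\<lambda>_. c)"
    using uv by simp
  also have "\<dots> \<le> integral {u..v} (\<lambda>y. g y * g y)"
    using d(2) uv by (intro integral_le int) (auto intro!: less_imp_le)
  also have "\<dots> \<le> integral {a..b} (\<lambda>y. g y * g y)"
    by (intro integral_subset_le sub int assms) auto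
  finally show False
    using assms(3) by simp
qed

subsection \<open>The truncated Marsden identity\<close>

text \<open>The product of \<open>y - t\<^sub>k\<^sub>+\<^sub>j\<close>, \<open>1 \<le> j \<le> d\<close>, as a polynomial in \<open>y - a\<close>.\<close>

definition dual_poly :: "(nat \<Rightarrow> real) \<Rightarrow> nat \<Rightarrow> real \<Rightarrow> nat \<Rightarrow> real poly" where
  "dual_poly t d a k = (\<Prod>j<d. [:a - t (k + Suc j), 1:])"

text \<open>
  Marsden's identity \<open>(y - x)\<^sup>d = \<Sum>\<^sub>k \<psi>\<^sub>k(y) N\<^sub>k(x)\<close>, modulo \<open>(y - a)\<^sup>r\<^sup>+\<^sup>1\<close> for a knot \<open>a\<close> of multiplicity at
  least \<open>r + 1\<close>. The B-splines reaching across \<open>a\<close> have all these copies of \<open>a\<close> among the roots of \<open>\<psi>\<^sub>k\<close> and drop out.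
\<close>

lemma truncated_marsden:
  assumes "mono t" "t K = a" "t (K + r) = a" "x < t M" "K \<le> M"
  shows "[:0, 1:] ^ Suc r dvd
    (\<Sum>k=K..<M. Polynomial.smult (bspline t d k x) (dual_poly t d a k)) - Polynomial.smult (trunc_pow a 0 x) ([:a - x, 1:] ^ d)"
proof (induction d)
  case 0
  have "(\<Sum>k=K..<M. bspline t 0 k x) = bstep t 0 K x - bstep t 0 M x"
    using assms(5) unfolding bspline_eq_bstep_diff[OF assms(1)]
    by (induction M rule: dec_induct) simp_all
  also have "\<dots> = trunc_pow a 0 x"
    using assms by (simp add: bstep_0 trunc_pow_def)
  finally have sum: "(\<Sum>k=K..<M. bspline t 0 k x) = trunc_pow a 0 x" .
  have "(\<Sum>k=K..<M. [:f k:]) = [:\<Sum>k=K..<M. f k:]" for f :: "nat \<Rightarrow> real"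
    using assms(5) by (induction M rule: dec_induct) simp_all
  with sum show ?case
    by (simp add: dual_poly_def del: bspline.simps)
next
  case (Suc d)
  define w where "w k = (x - t k) / (t (k + Suc d) - t k)" for k
  define N where "N k = bspline t d k x" for k
  define Q where "Q k = dual_poly t d a k" for k
  have rec: "bspline t (Suc d) k x = w k * N k + (1 - w (Suc k)) * N (Suc k)" for k
  proof -
    have "(t (k + Suc d + 1) - x) / (t (k + Suc d + 1) - t (k + 1)) * N (Suc k) = (1 - w (Suc k)) * N (Suc k)"
    proof (cases "t (Suc k) = t (Suc k + Suc d)")
      case True
      then show ?thesis
        using bspline_empty[OF assms(1) True] by (simp add: N_def)
    next
      case False
      then show ?thesis
        by (simp add: w_def field_simps)
    qed
    then show ?thesis
      by (simp add: w_def N_def)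
  qed
  have Qr: "dual_poly t (Suc d) a k = Q k * [:a - t (k + Suc d), 1:]" for k
    by (simp add: dual_poly_def Q_def)
  have Ql: "dual_poly t (Suc d) a k = [:a - t (Suc k), 1:] * Q (Suc k)" for k
    unfolding dual_poly_def Q_def by (subst prod.lessThan_Suc_shift) simp
  \<comment> \<open>\<open>w k\<close> is the weight that interpolates \<open>x\<close> linearly
    between \<open>t k\<close> and \<open>t (k + Suc d)\<close>; the same weight interpolates the
    linear factors of the dual polynomials.\<close>
  have lin: "Polynomial.smult (w k * N k) (Q k * [:a - t (k + Suc d), 1:])
      = Polynomial.smult (N k) ([:a - x, 1:] * Q k) - Polynomial.smult ((1 - w k) * N k) ([:a - t k, 1:] * Q k)" for k
  proof (cases "t k = t (k + Suc d)")
    case True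
    then show ?thesis
      using bspline_empty[OF assms(1) True] by (simp add: N_def)
  next
    case False
    then have 1: "w k * (t (k + Suc d) - t k) = x - t k"
      by (simp add: w_def)
    have "Polynomial.smult (w k) [:a - t (k + Suc d), 1:] + Polynomial.smult (1 - w k) [:a - t k, 1:]
        = [:a - t k - w k * (t (k + Suc d) - t k), 1:]"
      by (simp add: algebra_simps)
    also have "\<dots> = [:a - x, 1:]"
      unfolding 1 by simp
    finally have "Polynomial.smult (N k) (Q k * (Polynomial.smult (w k) [:a - t (k + Suc d), 1:] + Polynomial.smult (1 - w k) [:a - t k, 1:]))
        = Polynomial.smult (N k) (Q k * [:a - x, 1:])"
      by simp
    then show ?thesis
      by (simp only: distrib_left smult_add_right mult_smult_right smult_smult mult.commute eq_diff_eq)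
  qed
  \<comment> \<open>Removes the upper boundary term when the index of the second sum is shifted; the
    lower one, at \<open>K\<close>, remains.\<close>
  have NM: "N M = 0"
    unfolding N_def using assms(4) by (intro bspline_eq_0[OF assms(1)]) simp
  have "(\<Sum>k=K..<M. Polynomial.smult (bspline t (Suc d) k x) (dual_poly t (Suc d) a k))
      = (\<Sum>k=K..<M. Polynomial.smult (w k * N k) (Q k * [:a - t (k + Suc d), 1:]))
        + (\<Sum>k=K..<M. Polynomial.smult ((1 - w (Suc k)) * N (Suc k)) ([:a - t (Suc k), 1:] * Q (Suc k)))"
    unfolding rec by (simp only: smult_add_left sum.distrib flip: Qr Ql)
  also have "(\<Sum>k=K..<M. Polynomial.smult ((1 - w (Suc k)) * N (Suc k)) ([:a - t (Suc k), 1:] * Q (Suc k)))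
      = (\<Sum>k=K..<M. Polynomial.smult ((1 - w k) * N k) ([:a - t k, 1:] * Q k))
        - Polynomial.smult ((1 - w K) * N K) ([:a - t K, 1:] * Q K)"
    using assms(5) sum_Suc_diff'[of K M "\<lambda>k. Polynomial.smult ((1 - w k) * N k) ([:a - t k, 1:] * Q k)"] NM
    by (simp only: sum_subtractf) (simp add: algebra_simps)
  also have "(\<Sum>k=K..<M. Polynomial.smult (w k * N k) (Q k * [:a - t (k + Suc d), 1:]))
      = [:a - x, 1:] * (\<Sum>k=K..<M. Polynomial.smult (N k) (Q k)) - (\<Sum>k=K..<M. Polynomial.smult ((1 - w k) * N k) ([:a - t k, 1:] * Q k))"
    unfolding lin sum_subtractf sum_distrib_left mult_smult_right ..
  finally have eq: "(\<Sum>k=K..<M. Polynomial.smult (bspline t (Suc d) k x) (dual_poly t (Suc d) a k))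
        - Polynomial.smult (trunc_pow a 0 x) ([:a - x, 1:] ^ Suc d)
      = [:a - x, 1:] * ((\<Sum>k=K..<M. Polynomial.smult (N k) (Q k)) - Polynomial.smult (trunc_pow a 0 x) ([:a - x, 1:] ^ d))
        - Polynomial.smult ((1 - w K) * N K) ([:a - t K, 1:] * Q K)"
    by (simp only: right_diff_distrib mult_smult_right power_Suc)
  \<comment> \<open>The boundary term at \<open>K\<close> carries one root for each of the
    \<open>r + 1\<close> copies of \<open>a\<close>. If there are too many copies to fit among the
    factors, then \<open>N K\<close> itself is 0.\<close>
  have "[:0, 1:] ^ Suc r dvd Polynomial.smult ((1 - w K) * N K) ([:a - t K, 1:] * Q K)"
  proof (cases "r \<le> d")
    case True
    have "Q K = (\<Prod>j<r. [:a - t (K + Suc j), 1:]) * (\<Prod>j\<in>{r..<d}. [:a - t (K + Suc j), 1:])"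
      unfolding Q_def dual_poly_def lessThan_atLeast0
      by (rule prod.atLeastLessThan_concat[symmetric]) (use True in simp_all)
    also have "(\<Prod>j<r. [:a - t (K + Suc j), 1:]) = (\<Prod>j<r. [:0, 1:])"
    proof (rule prod.cong)
      fix j assume "j \<in> {..<r}"
      then have "t (K + Suc j) = t K"
        using assms by (intro mono_eq_knots[OF assms(1), of K "K + r"]) auto
      then show "[:a - t (K + Suc j), 1:] = [:0, 1:]"
        using assms(2) by simp
    qed simp
    finally have "[:0, 1:] ^ Suc r dvd [:a - t K, 1:] * Q K"
      using assms(2) by (simp add: mult.assoc[symmetric] del: mult_pCons_left)
    then show ?thesis
      by (rule dvd_smult)
  next
    case False
    then have "t (K + Suc d) = t K"
      using assms by (intro mono_eq_knots[OF assms(1), of K "K + r"]) auto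
    then have "N K = 0"
      unfolding N_def by (intro bspline_empty[OF assms(1)]) simp
    then show ?thesis
      by simp
  qed
  then show ?case
    unfolding eq by (rule dvd_diff[OF dvd_mult[OF Suc.IH[folded N_def Q_def]]])
qed

text \<open>Compare the coefficients of degree \<open>r\<close> in \<open>truncated_marsden\<close>:
  the modulus has order \<open>r + 1\<close> and leaves them intact, and on the power side
  \<open>(a - x) ^ (d - r)\<close> appears with a binomial factor. The constant \<open>b\<close>
  collects this factor and the sign.\<close>

lemma trunc_pow_in_bspline_span:
  assumes "mono t" "t K = a" "t (K + r) = a" "r \<le> d"
  shows "\<exists>c. \<forall>x<t M. trunc_pow a (d - r) x = (\<Sum>k<M. c k * bspline t d k x)"
proof (cases "K \<le> M")
  case True
  define b where "b = real (d choose r) * (-1) ^ (d - r)"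
  have b: "b \<noteq> 0"
    using assms(4) by (simp add: b_def)
  define c where "c k = (if K \<le> k then coeff (dual_poly t d a k) r / b else 0)" for k
  have "trunc_pow a (d - r) x = (\<Sum>k<M. c k * bspline t d k x)" if "x < t M" for x
  proof -
    define p where "p = (\<Sum>k=K..<M. Polynomial.smult (bspline t d k x) (dual_poly t d a k))"
    have "monom 1 (Suc r) dvd p - Polynomial.smult (trunc_pow a 0 x) ([:a - x, 1:] ^ d)"
      using truncated_marsden[OF assms(1-3) that True, of d] unfolding p_def
      by (simp add: monom_altdef)
    then have "coeff (p - Polynomial.smult (trunc_pow a 0 x) ([:a - x, 1:] ^ d)) r = 0"
      unfolding monom_1_dvd_iff' by simp
    then have "coeff p r = trunc_pow a 0 x * (real (d choose r) * (a - x) ^ (d - r))"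
      using assms(4) by (simp add: coeff_linear_poly_power)
    also have "\<dots> = b * trunc_pow a (d - r) x"
    proof -
      have "(a - x) ^ (d - r) = (-1) ^ (d - r) * (x - a) ^ (d - r)"
        by (simp flip: power_mult_distrib)
      then show ?thesis
        by (simp add: trunc_pow_def b_def)
    qed
    finally have "trunc_pow a (d - r) x = coeff p r / b"
      using b by simp
    also have "coeff p r / b = (\<Sum>k=K..<M. c k * bspline t d k x)"
      unfolding p_def coeff_sum sum_divide_distrib by (intro sum.cong) (auto simp: c_def)
    also have "\<dots> = (\<Sum>k<M. c k * bspline t d k x)"
      by (rule sum.mono_neutral_left) (auto simp: c_def)
    finally show ?thesis .
  qed
  then show ?thesis
    by blast
next
  case False
  then have "trunc_pow a (d - r) x = 0" if "x < t M" for x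
    using that assms(2) monoD[OF assms(1), of M K] by (simp add: trunc_pow_def)
  then show ?thesis
    by (intro exI[of _ "\<lambda>_. 0"]) simp
qed

subsection \<open>Products of B-splines\<close>

text \<open>The product starts at the larger knot \<open>b\<close>; to the right of it, expand
  \<open>x - a = (x - b) + (b - a)\<close>.\<close>

lemma trunc_pow_mult:
  assumes "a \<le> b"
  shows "trunc_pow a e x * trunc_pow b f x
    = (\<Sum>i\<le>e. real (e choose i) * (b - a) ^ (e - i) * trunc_pow b (f + i) x)"
proof (cases "b \<le> x")
  case True
  have "(x - a) ^ e = (\<Sum>i\<le>e. real (e choose i) * (x - b) ^ i * (b - a) ^ (e - i))"
    using binomial_ring[of "x - b" "b - a" e] by simp
  then show ?thesis
    using True assms by (simp add: trunc_pow_def sum_distrib_left sum_distrib_right power_add mult_ac)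
next
  case False
  then show ?thesis
    by (simp add: trunc_pow_def)
qed

text \<open>Equality is required only to the left of \<open>t M\<close>: truncated powers do not
  vanish far to the right, whereas finitely many B-splines do.\<close>

definition bspline_span :: "(nat \<Rightarrow> real) \<Rightarrow> nat \<Rightarrow> nat \<Rightarrow> (real \<Rightarrow> real) set" where
  "bspline_span t d M = {f. \<exists>c. \<forall>x<t M. f x = (\<Sum>k<M. c k * bspline t d k x)}"

lemma bspline_span_0: "(\<lambda>x. 0) \<in> bspline_span t d M"
  unfolding bspline_span_def by (auto intro!: exI[of _ "\<lambda>_. 0"])

lemma bspline_span_add:
  assumes "f \<in> bspline_span t d M" "g \<in> bspline_span t d M"
  shows "(\<lambda>x. f x + g x) \<in> bspline_span t d M"
proof -
  obtain c c' where "\<forall>x<t M. f x = (\<Sum>k<M. c k * bspline t d k x)"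
    and "\<forall>x<t M. g x = (\<Sum>k<M. c' k * bspline t d k x)"
    using assms unfolding bspline_span_def by auto
  then show ?thesis
    unfolding bspline_span_def
    by (auto intro!: exI[of _ "\<lambda>k. c k + c' k"] simp: sum.distrib distrib_right)
qed

lemma bspline_span_scale:
  assumes "f \<in> bspline_span t d M"
  shows "(\<lambda>x. a * f x) \<in> bspline_span t d M"
proof -
  obtain c where "\<forall>x<t M. f x = (\<Sum>k<M. c k * bspline t d k x)"
    using assms unfolding bspline_span_def by auto
  then show ?thesis
    unfolding bspline_span_def
    by (auto intro!: exI[of _ "\<lambda>k. a * c k"] simp: sum_distrib_left mult.assoc)
qed

lemma bspline_span_diff:
  assumes "f \<in> bspline_span t d M" "g \<in> bspline_span t d M"
  shows "(\<lambda>x. f x - g x) \<in> bspline_span t d M"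
  using bspline_span_add[OF assms(1) bspline_span_scale[OF assms(2), of "-1"]] by simp

lemma bspline_span_sum:
  assumes "\<And>i. i \<in> I \<Longrightarrow> f i \<in> bspline_span t d M"
  shows "(\<lambda>x. \<Sum>i\<in>I. f i x) \<in> bspline_span t d M"
  using assms
  by (induction I rule: infinite_finite_induct) (auto intro: bspline_span_0 bspline_span_add)

text \<open>Unrolling the recursion ends in truncated powers at repeated knots, with the exponent
  lowered by \<open>r\<close> only if \<open>t k\<close> to \<open>t (k + r)\<close> coincide. The
  factor \<open>g\<close> lets this be applied to the two factors of a product in turn.\<close>

lemma ddiff_mult_in_bspline_span:
  assumes "\<And>k r. k + r \<le> L \<Longrightarrow> t k = t (k + r) \<Longrightarrow> r \<le> d \<Longrightarrow>
      (\<lambda>x. trunc_pow (t k) (d - r) x * g x) \<in> bspline_span u e M"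
    and "k + m \<le> L" "m \<le> d"
  shows "(\<lambda>x. ddiff t d m k x * g x) \<in> bspline_span u e M"
  using assms(2,3)
proof (induction m arbitrary: k)
  case 0
  then show ?case
    using assms(1)[of k 0] by simp
next
  case (Suc m)
  show ?case
  proof (cases "t k = t (k + Suc m)")
    case True
    show ?thesis
      using bspline_span_scale[OF assms(1)[OF Suc.prems(1) True Suc.prems(2)],
          of "(-1) ^ Suc m * real (d choose Suc m)"]
      unfolding ddiff_eq_knots[OF True] by (simp only: mult.assoc)
  next
    case False
    define h where "h = t (k + Suc m) - t k"
    have "(\<lambda>x. 1 / h * (ddiff t d m (k + 1) x * g x - ddiff t d m k x * g x)) \<in> bspline_span u e M"
      using Suc.prems by (intro bspline_span_scale bspline_span_diff Suc.IH) auto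
    moreover have "ddiff t d (Suc m) k x * g x
        = 1 / h * (ddiff t d m (k + 1) x * g x - ddiff t d m k x * g x)" for x
      using False by (simp add: h_def left_diff_distrib)
    ultimately show ?thesis
      by simp
  qed
qed

text \<open>A count of multiplicities: \<open>r + 1\<close> copies of \<open>t k\<close> become
  \<open>(n + 1) * (r + 1)\<close> copies in \<open>u\<close>, while the product loses at most
  \<open>n + r\<close> from the full exponent \<open>2 * n\<close>.\<close>

lemma trunc_pow_mult_in_bspline_span:
  assumes "mono t" "mono u" "\<And>i. i div (n + 1) \<le> L \<Longrightarrow> u i = t (i div (n + 1))"
    and "a \<le> t k" "e \<le> n" "k + r \<le> L" "t k = t (k + r)" "r \<le> n"
  shows "(\<lambda>x. trunc_pow a e x * trunc_pow (t k) (n - r) x) \<in> bspline_span u (2 * n) M"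
proof -
  have "(\<lambda>x. trunc_pow (t k) (n - r + i) x) \<in> bspline_span u (2 * n) M" if "i \<le> e" for i
  proof -
    \<comment> \<open>\<open>R\<close> is the loss in the exponent,
      \<open>n - r + i = 2 * n - R\<close>, and \<open>K\<close> is the position of the first copy
      of the knot with index \<open>k\<close> in \<open>u\<close>.\<close>
    define R where "R = n + r - i"
    define K where "K = (n + 1) * k"
    have deg: "n - r + i = 2 * n - R" "R \<le> 2 * n"
      using that assms by (simp_all add: R_def)
    have "R < (n + 1) * (r + 1)"
      by (simp add: R_def algebra_simps)
    then have "(K + R) div (n + 1) < k + (r + 1)"
      unfolding K_def by (subst div_less_iff_less_mult) (simp_all add: algebra_simps)
    then have R: "(K + R) div (n + 1) \<le> k + r"
      by simp
    have K: "K div (n + 1) = k"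
      unfolding K_def by (rule nonzero_mult_div_cancel_left) simp
    have le: "k \<le> (K + R) div (n + 1)"
      using div_le_mono[of K "K + R" "n + 1"] K by simp
    have uK: "u K = t k"
      using assms(3)[of K] assms(6) K by simp
    have "u (K + R) = t ((K + R) div (n + 1))"
      using assms(3)[of "K + R"] assms(6) R by simp
    also have "\<dots> = t k"
      by (rule mono_eq_knots[OF assms(1,7) le R])
    finally show ?thesis
      unfolding bspline_span_def deg(1) using trunc_pow_in_bspline_span[OF assms(2) uK _ deg(2)] by simp
  qed
  then have "(\<lambda>x. \<Sum>i\<le>e. real (e choose i) * (t k - a) ^ (e - i) * trunc_pow (t k) (n - r + i) x)
      \<in> bspline_span u (2 * n) M"
    by (intro bspline_span_sum bspline_span_scale) auto
  then show ?thesis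
    unfolding trunc_pow_mult[OF assms(4)] .
qed

text \<open>Expand both B-splines into steps and these into truncated powers, one factor at a time;
  each pair of truncated powers is ordered so that the larger knot comes second.\<close>

lemma bspline_mult_in_bspline_span:
  assumes "mono t" "mono u" "\<And>i. i div (n + 1) \<le> L \<Longrightarrow> u i = t (i div (n + 1))"
    and "i + n + 1 \<le> L" "j + n + 1 \<le> L"
  shows "(\<lambda>x. bspline t n i x * bspline t n j x) \<in> bspline_span u (2 * n) M"
proof -
  have "(\<lambda>x. trunc_pow (t k) (n - r) x * trunc_pow (t k') (n - r') x) \<in> bspline_span u (2 * n) M"
    if "k + r \<le> L" "t k = t (k + r)" "r \<le> n" "k' + r' \<le> L" "t k' = t (k' + r')" "r' \<le> n" for k r k' r'
  proof (cases "t k \<le> t k'")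
    case True
    show ?thesis
      by (rule trunc_pow_mult_in_bspline_span[where L = L, OF assms(1,2) _ True])
        (rule assms(3) that diff_le_self | assumption)+
  next
    case False
    then have le: "t k' \<le> t k"
      by simp
    have "(\<lambda>x. trunc_pow (t k') (n - r') x * trunc_pow (t k) (n - r) x) \<in> bspline_span u (2 * n) M"
      by (rule trunc_pow_mult_in_bspline_span[where L = L, OF assms(1,2) _ le])
        (rule assms(3) that diff_le_self | assumption)+
    then show ?thesis
      by (simp only: mult.commute)
  qed
  then have "(\<lambda>x. ddiff t n n k x * trunc_pow (t k') (n - r') x) \<in> bspline_span u (2 * n) M"
    if "k' + r' \<le> L" "t k' = t (k' + r')" "r' \<le> n" "k + n \<le> L" for k' r' k
    using that by (intro ddiff_mult_in_bspline_span) auto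
  then have "(\<lambda>x. trunc_pow (t k') (n - r') x * ddiff t n n k x) \<in> bspline_span u (2 * n) M"
    if "k' + r' \<le> L" "t k' = t (k' + r')" "r' \<le> n" "k + n \<le> L" for k' r' k
    using that by (simp only: mult.commute[of "trunc_pow _ _ _"])
  then have D: "(\<lambda>x. ddiff t n n k' x * ddiff t n n k x) \<in> bspline_span u (2 * n) M"
    if "k' + n \<le> L" "k + n \<le> L" for k' k
    using that by (intro ddiff_mult_in_bspline_span) auto
  have "(\<lambda>x. bstep t n k' x * bstep t n k x) \<in> bspline_span u (2 * n) M"
    if "k' + n \<le> L" "k + n \<le> L" for k' k
    using D[OF that] unfolding ddiff_eq_bstep by (cases "even n") simp_all
  then have "(\<lambda>x. (bstep t n i x * bstep t n j x - bstep t n i x * bstep t n (j + 1) x)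
      - (bstep t n (i + 1) x * bstep t n j x - bstep t n (i + 1) x * bstep t n (j + 1) x))
      \<in> bspline_span u (2 * n) M"
    using assms(4,5) by (intro bspline_span_diff) auto
  then show ?thesis
    unfolding bspline_eq_bstep_diff[OF assms(1)] by (simp add: algebra_simps)
qed

lemma mono_repeat_knots: "mono t \<Longrightarrow> mono (repeat_knots m t)"
  unfolding repeat_knots_def by (intro monoI) (auto intro: monoD div_le_mono)

text \<open>\<open>L\<close> is the last index of the original knots. A B-spline of degree
  \<open>2 * n\<close> occupies \<open>2 * n + 2\<close> of the \<open>(L + 1) * (n + 1)\<close>
  repeated knots, so the size equation makes \<open>q\<close> the last index.\<close>

lemma bspline_mult_expansion:
  assumes "mono t" "s = repeat_knots (n + 1) t" "(L + 1) * (n + 1) = q + 2 * n + 2"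
    and "i + n + 1 \<le> L" "j + n + 1 \<le> L"
  shows "\<exists>c. \<forall>x. bspline t n i x * bspline t n j x = (\<Sum>k\<le>q. c k * bspline s (2 * n) k x)"
proof -
  define N where "N = q + 2 * n + 2"
  \<comment> \<open>Simple knots behind the last one: the truncated powers do not vanish there, but the product does,
      which by local independence kills the coefficients beyond \<open>q\<close>.\<close>
  define u where "u i = (if i < N then s i else s (N - 1) + (real i - real N + 1))" for i
  have N: "N = (L + 1) * (n + 1)"
    using assms(3) by (simp add: N_def)
  have mono_s: "mono s"
    using assms(1,2) mono_repeat_knots by simp
  have mono_u: "mono u"
  proof (rule monoI)
    fix i j :: nat
    assume ij: "i \<le> j"
    show "u i \<le> u j"
    proof (cases "i < N \<and> \<not> j < N")
      case True
      then have "s i \<le> s (N - 1)" "real N \<le> real j"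
        by (auto intro: monoD[OF mono_s])
      then have "s i \<le> s (N - 1) + (real j - real N + 1)"
        by linarith
      then show ?thesis
        using True by (simp add: u_def)
    next
      case False
      then show ?thesis
        using ij monoD[OF mono_s ij] by (auto simp: u_def)
    qed
  qed
  have div_le: "i div (n + 1) \<le> L \<longleftrightarrow> i < N" for i
    unfolding N using div_less_iff_less_mult[of "n + 1" i "L + 1"] by (simp add: less_Suc_eq_le)
  have u: "u i = t (i div (n + 1))" if "i div (n + 1) \<le> L" for i
    using that unfolding div_le by (simp add: u_def assms(2) repeat_knots_def)
  have "(N - 1) div (n + 1) = L"
    unfolding N by (rule div_nat_eqI) (simp_all add: algebra_simps)
  then have last: "u (q + 2 * n + 1) = t L"
    using u[of "N - 1"] by (simp add: N_def)
  have uN: "u (Suc (q + 2 * n + 1)) > u (q + 2 * n + 1)"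
    by (simp add: u_def N_def)
  have same: "bspline u (2 * n) k x = bspline s (2 * n) k x" if "k \<le> q" for k x
    using that by (intro bspline_cong) (simp add: u_def N_def)
  have vanish: "bspline t n i x = 0" if "t L \<le> x" for x
    using that monoD[OF assms(1), of "i + Suc n" L] assms(4) by (intro bspline_eq_0[OF assms(1)]) auto
  obtain c where c: "bspline t n i x * bspline t n j x = (\<Sum>k<N. c k * bspline u (2 * n) k x)"
    if "x < u N" for x
    using bspline_mult_in_bspline_span[OF assms(1) mono_u u assms(4,5), of N]
    unfolding bspline_span_def by auto
  \<comment> \<open>The surplus indices \<open>q + 1\<close> to \<open>q + 2 * n + 1\<close> are
    exactly those of the B-splines active on the interval just behind the knot
    \<open>t L\<close>.\<close>
  have "c k = 0" if "k \<in> {..<N} - {..q}" for k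
  proof (rule bspline_local_independent[OF mono_u uN])
    fix x assume "u (q + 2 * n + 1) < x" "x < u (Suc (q + 2 * n + 1))"
    then show "(\<Sum>i\<le>q + 2 * n + 1. c i * bspline u (2 * n) i x) = 0"
      using c[of x] vanish[of x] last by (simp add: N_def lessThan_Suc_atMost)
  qed (use that in \<open>auto simp: N_def\<close>)
  then have c': "(\<Sum>k<N. c k * bspline u (2 * n) k x) = (\<Sum>k\<le>q. c k * bspline s (2 * n) k x)" for x
    using same by (intro sum.mono_neutral_cong_right) (auto simp: N_def)
  have "bspline t n i x * bspline t n j x = (\<Sum>k\<le>q. c k * bspline s (2 * n) k x)" for x
  proof (cases "x < u N")
    case True
    then show ?thesis
      using c c' by simp
  next
    case False
    then have x: "u (q + 2 * n + 1) \<le> x"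
      using uN by (simp add: N_def)
    then have "bspline s (2 * n) k x = 0" if "k \<le> q" for k
      using that monoD[OF mono_u, of "k + Suc (2 * n)" "q + 2 * n + 1"]
      unfolding same[OF that, symmetric] by (intro bspline_eq_0[OF mono_u]) auto
    then show ?thesis
      using vanish[of x] x last by simp
  qed
  then show ?thesis
    by blast
qed

subsection \<open>Gramian systems and spline integrals\<close>

lemma invertible_mat_if_trivial_kernel:
  fixes A :: "real mat"
  assumes "A \<in> carrier_mat m m"
    and "\<And>v. v \<in> carrier_vec m \<Longrightarrow> A *\<^sub>v v = 0\<^sub>v m \<Longrightarrow> v = 0\<^sub>v m"
  shows "invertible_mat A"
proof -
  have "Determinant.det A \<noteq> 0"
    using det_0_iff_vec_prod_zero_field[OF assms(1)] assms(2) by blast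
  then have "A \<in> Units (ring_mat TYPE(real) m ())"
    by (rule det_non_zero_imp_unit[OF assms(1)])
  then obtain B where "B \<in> carrier_mat m m" "A * B = 1\<^sub>m m" "B * A = 1\<^sub>m m"
    unfolding Units_def ring_mat_def by auto
  then show ?thesis
    using assms(1) unfolding invertible_mat_def inverts_mat_def by auto
qed

text \<open>Gramians of families that are continuous from the right. The half-open support in
  \<open>supp\<close> is what extends vanishing on \<open>a \<le> x < b\<close> to the whole line,
  including \<open>b\<close>.\<close>

context
  fixes f :: "nat \<Rightarrow> real \<Rightarrow> real" and q :: nat and a b :: real and A :: "real mat"
  assumes cont: "\<And>k x. continuous (at_right x) (f k)"
    and int: "\<And>k l. (\<lambda>x. f k x * f l x) integrable_on {a..b}"
    and supp: "\<And>k x. k \<le> q \<Longrightarrow> x < a \<or> b \<le> x \<Longrightarrow> f k x = 0"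
    and A: "A = Matrix.mat (q + 1) (q + 1) (\<lambda>(k, l). integral {a..b} (\<lambda>x. f k x * f l x))"
begin

lemma gram_mult_vec_index:
  assumes "\<xi> \<in> carrier_vec (q + 1)" "l \<le> q"
  shows "vec_index (A *\<^sub>v \<xi>) l = integral {a..b} (\<lambda>x. (\<Sum>k\<le>q. vec_index \<xi> k * f k x) * f l x)"
proof -
  have "integral {a..b} (\<lambda>x. (\<Sum>k\<le>q. vec_index \<xi> k * f k x) * f l x)
      = integral {a..b} (\<lambda>x. \<Sum>k\<le>q. vec_index \<xi> k * (f l x * f k x))"
    by (simp add: sum_distrib_left sum_distrib_right mult_ac)
  also have "\<dots> = (\<Sum>k\<le>q. vec_index \<xi> k * integral {a..b} (\<lambda>x. f l x * f k x))"
    using int by (subst integral_sum) (auto intro: integrable_on_mult_right)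
  also have "\<dots> = vec_index (A *\<^sub>v \<xi>) l"
    using assms unfolding A
    by (simp add: scalar_prod_def lessThan_atLeast0[symmetric] lessThan_Suc_atMost[symmetric] mult.commute
        del: sum.lessThan_Suc)
  finally show ?thesis ..
qed

text \<open>The combination \<open>g\<close> is orthogonal to every \<open>f l\<close>, hence to
  itself, so its square has integral 0. For a dependent family, a kernel vector is thus a
  representation of the zero function.\<close>

lemma gram_kernel:
  assumes \<xi>: "\<xi> \<in> carrier_vec (q + 1)" and 0: "A *\<^sub>v \<xi> = 0\<^sub>v (q + 1)"
  shows "(\<Sum>k\<le>q. vec_index \<xi> k * f k x) = 0"
proof -
  define g where "g x = (\<Sum>k\<le>q. vec_index \<xi> k * f k x)" for x
  have gf: "(\<lambda>x. g x * f l x) integrable_on {a..b}" for l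
    unfolding g_def sum_distrib_right mult.assoc
    by (intro integrable_sum integrable_on_mult_right int) simp
  have gg: "g x * g x = (\<Sum>l\<le>q. vec_index \<xi> l * (g x * f l x))" for x
    by (subst (2) g_def) (simp add: sum_distrib_left mult_ac)
  have "integral {a..b} (\<lambda>x. g x * f l x) = 0" if "l \<le> q" for l
    using gram_mult_vec_index[OF \<xi> that] that unfolding 0 g_def by simp
  then have "integral {a..b} (\<lambda>x. g x * g x) = 0"
    unfolding gg using gf by (subst integral_sum) (auto intro: integrable_on_mult_right)
  moreover have "(\<lambda>x. g x * g x) integrable_on {a..b}"
    unfolding gg by (intro integrable_sum integrable_on_mult_right gf) simp
  moreover have "continuous (at_right x) g" for x
    unfolding g_def by (intro continuous_intros cont)
  ultimately have "g x = 0" if "a \<le> x" "x < b" for x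
    using that integral_square_eq_0_imp_eq_0 by blast
  moreover have "g x = 0" if "\<not> (a \<le> x \<and> x < b)" for x
    using that supp by (auto simp: g_def not_le not_less)
  ultimately show ?thesis
    unfolding g_def by blast
qed

text \<open>Integrating a representation of \<open>g\<close> against each \<open>f l\<close> yields
  the system. Conversely, two solutions differ by a kernel vector and so represent the same
  function, even if \<open>A\<close> is singular, as happens for coincident knots.\<close>

lemma gram_system:
  assumes g: "\<And>x. g x = (\<Sum>k\<le>q. c k * f k x)"
    and b: "v = Matrix.vec (q + 1) (\<lambda>l. integral {a..b} (\<lambda>x. g x * f l x))"
  shows "\<exists>\<xi>\<in>carrier_vec (q + 1). A *\<^sub>v \<xi> = v"
    and "\<xi> \<in> carrier_vec (q + 1) \<Longrightarrow> A *\<^sub>v \<xi> = v \<longleftrightarrow> (\<forall>x. g x = (\<Sum>k\<le>q. vec_index \<xi> k * f k x))"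
proof -
  have A': "A \<in> carrier_mat (q + 1) (q + 1)"
    unfolding A by simp
  have sol: "A *\<^sub>v \<xi> = v" if "\<xi> \<in> carrier_vec (q + 1)" "\<forall>x. g x = (\<Sum>k\<le>q. vec_index \<xi> k * f k x)" for \<xi>
  proof (rule eq_vecI)
    show "vec_index (A *\<^sub>v \<xi>) l = vec_index v l" if "l < dim_vec v" for l
      using that gram_mult_vec_index[OF \<open>\<xi> \<in> _\<close>, of l] \<open>\<forall>x. _ x = _\<close> unfolding b by simp
  qed (use A' b in simp)
  define \<eta> where "\<eta> = Matrix.vec (q + 1) c"
  have \<eta>: "\<eta> \<in> carrier_vec (q + 1)" "\<forall>x. g x = (\<Sum>k\<le>q. vec_index \<eta> k * f k x)"
    unfolding \<eta>_def using g by simp_all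
  show "\<exists>\<xi>\<in>carrier_vec (q + 1). A *\<^sub>v \<xi> = v"
    using sol[OF \<eta>] \<eta>(1) by blast
  show "A *\<^sub>v \<xi> = v \<longleftrightarrow> (\<forall>x. g x = (\<Sum>k\<le>q. vec_index \<xi> k * f k x))" if \<xi>: "\<xi> \<in> carrier_vec (q + 1)"
  proof
    assume "A *\<^sub>v \<xi> = v"
    then have "A *\<^sub>v (\<xi> - \<eta>) = 0\<^sub>v (q + 1)"
      using mult_minus_distrib_mat_vec[OF A' \<xi> \<eta>(1)] sol[OF \<eta>] b by simp
    then have "(\<Sum>k\<le>q. vec_index (\<xi> - \<eta>) k * f k x) = 0" for x
      using \<xi> \<eta>(1) by (intro gram_kernel) auto
    moreover have "(\<Sum>k\<le>q. vec_index (\<xi> - \<eta>) k * f k x)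
        = (\<Sum>k\<le>q. vec_index \<xi> k * f k x) - (\<Sum>k\<le>q. vec_index \<eta> k * f k x)" for x
      unfolding sum_subtractf[symmetric] using \<xi> \<eta>(1) by (intro sum.cong) (auto simp: left_diff_distrib)
    ultimately show "\<forall>x. g x = (\<Sum>k\<le>q. vec_index \<xi> k * f k x)"
      using \<eta>(2) by simp
  qed (rule sol[OF \<xi>])
qed

lemma gram_invertible:
  assumes "linearly_independent_on {a..b} {..q} f"
  shows "invertible_mat A"
proof (rule invertible_mat_if_trivial_kernel[where m = "q + 1"])
  fix v :: "real Matrix.vec"
  assume v: "v \<in> carrier_vec (q + 1)" "A *\<^sub>v v = 0\<^sub>v (q + 1)"
  then have "\<forall>k\<in>{..q}. vec_index v k = 0"
    using assms gram_kernel[OF v] unfolding linearly_independent_on_def by blast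
  then show "v = 0\<^sub>v (q + 1)"
    using v(1) by (intro eq_vecI) auto
qed (simp add: A)

end

text \<open>In this range the first step is 1 and the last is 0, so adding a constant to all
  coefficients adds it to the curve.\<close>

lemma spline_sum_by_parts:
  assumes "mono u" "u d \<le> x" "x \<le> u (Suc m)" "x < u (Suc m + d)"
  shows "spline u d m R x = R 0 + (\<Sum>k<m. bstep u d (Suc k) x *\<^sub>R (R (Suc k) - R k))"
  unfolding spline_def bspline_sum_by_parts[OF assms(1)]
  using bstep_eq_1[OF assms(1), of 0 d x] bstep_eq_0[OF assms(1,3,4)] assms(2) by simp

text \<open>The integral of a B-spline is a multiple of an increment of the step with the same
  index. The recurrence for \<open>R\<close> matches these multiples with the coefficients in
  \<open>spline_sum_by_parts\<close>.\<close>

lemma spline_indefinite_integral: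
  fixes R P :: "nat \<Rightarrow> complex"
  assumes "mono u" "\<And>x. x \<in> D \<Longrightarrow> u (Suc d) \<le> x \<and> x \<le> u (Suc m) \<and> x < u (Suc m + Suc d)"
    and "\<And>k. k < m \<Longrightarrow> R (Suc k) = R k + ((u (Suc k + Suc d) - u (Suc k)) / real (Suc d)) *\<^sub>R P k"
  shows "indefinite_integral_on D (\<lambda>x. \<Sum>k<m. bspline u d (Suc k) x *\<^sub>R P k) (spline u (Suc d) m R)"
  unfolding indefinite_integral_on_def
proof (intro ballI impI)
  fix x y assume xy: "x \<in> D" "y \<in> D" "x \<le> y"
  define w where "w k = ((u (Suc k + Suc d) - u (Suc k)) / real (Suc d)) *
    (bstep u (Suc d) (Suc k) y - bstep u (Suc d) (Suc k) x)" for k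
  have "((\<lambda>x. \<Sum>k<m. bspline u d (Suc k) x *\<^sub>R P k) has_integral (\<Sum>k<m. w k *\<^sub>R P k)) {x..y}"
    unfolding w_def by (intro has_integral_sum has_integral_scaleR_left bspline_has_integral assms xy) simp
  moreover have "(\<Sum>k<m. w k *\<^sub>R P k) = spline u (Suc d) m R y - spline u (Suc d) m R x"
  proof -
    have "spline u (Suc d) m R y - spline u (Suc d) m R x
        = (\<Sum>k<m. (bstep u (Suc d) (Suc k) y - bstep u (Suc d) (Suc k) x) *\<^sub>R (R (Suc k) - R k))"
      using spline_sum_by_parts[OF assms(1), of "Suc d" _ m R] assms(2)[OF xy(1)] assms(2)[OF xy(2)]
      by (simp add: sum_subtractf scaleR_left_diff_distrib)
    also have "\<dots> = (\<Sum>k<m. w k *\<^sub>R P k)"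
      using assms(3) by (intro sum.cong) (simp_all add: w_def mult.commute)
    finally show ?thesis ..
  qed
  ultimately show "((\<lambda>x. \<Sum>k<m. bspline u d (Suc k) x *\<^sub>R P k) has_integral
      (spline u (Suc d) m R y - spline u (Suc d) m R x)) {x..y}"
    by simp
qed

text \<open>Near \<open>x\<close> the integrand stays within \<open>e\<close> of \<open>f x\<close>,
  so the increment of \<open>F\<close> deviates from the linear one by at most \<open>e\<close>
  times the length. The estimate is made inside \<open>D\<close>, which may be half-open.\<close>

lemma indefinite_integral_has_vector_derivative:
  assumes F: "indefinite_integral_on D f F" and D: "is_interval D" "x \<in> D"
    and cont: "continuous (at x within D) f"
  shows "(F has_vector_derivative f x) (at x within D)"
  unfolding has_vector_derivative_def has_derivative_within_alt
proof (intro conjI allI impI)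
  show "bounded_linear (\<lambda>h. h *\<^sub>R f x)"
    by (rule bounded_linear_scaleR_left)
  fix e :: real assume e: "0 < e"
  then obtain d where d: "d > 0" "\<And>y. y \<in> D \<Longrightarrow> dist y x < d \<Longrightarrow> dist (f y) (f x) < e"
    using cont unfolding continuous_within_eps_delta by blast
  have bound: "norm (F v - F u - (v - u) *\<^sub>R f x) \<le> e * (v - u)"
    if uv: "u \<in> D" "v \<in> D" "u \<le> v" "\<And>y. y \<in> {u..v} \<Longrightarrow> dist y x < d" for u v
  proof -
    have "((\<lambda>y. f x) has_integral (v - u) *\<^sub>R f x) {u..v}"
      using has_integral_const_real[of "f x" u v] uv(3) by simp
    moreover have "(f has_integral (F v - F u)) {u..v}"
      using F uv(1-3) unfolding indefinite_integral_on_def by blast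
    ultimately have "((\<lambda>y. f y - f x) has_integral (F v - F u - (v - u) *\<^sub>R f x)) {u..v}"
      by (intro has_integral_diff)
    moreover have "norm (f y - f x) \<le> e" if "y \<in> {u..v}" for y
    proof -
      have "y \<in> D"
        using mem_is_interval_1_I[OF D(1) uv(1,2)] that by simp
      then show ?thesis
        using d(2)[of y] uv(4)[OF that] by (intro less_imp_le) (simp add: dist_norm)
    qed
    ultimately show ?thesis
      using has_integral_bound_real[of e "{}" "\<lambda>y. f y - f x" _ u v] e uv(3) by (simp add: content_real)
  qed
  show "\<exists>d>0. \<forall>y\<in>D. norm (y - x) < d \<longrightarrow> norm (F y - F x - (y - x) *\<^sub>R f x) \<le> e * norm (y - x)"
  proof (intro exI[of _ d] conjI ballI impI)
    fix y assume y: "y \<in> D" "norm (y - x) < d"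
    show "norm (F y - F x - (y - x) *\<^sub>R f x) \<le> e * norm (y - x)"
    proof (cases "x \<le> y")
      case True
      then show ?thesis
        using bound[OF D(2) y(1)] y(2) by (simp add: dist_real_def)
    next
      case False
      then have "norm (F x - F y - (x - y) *\<^sub>R f x) \<le> e * (x - y)"
        using bound[OF y(1) D(2)] y(2) by (simp add: dist_real_def)
      moreover have "F y - F x - (y - x) *\<^sub>R f x = - (F x - F y - (x - y) *\<^sub>R f x)"
        by (simp add: algebra_simps)
      ultimately show ?thesis
        using False by (simp only: norm_minus_cancel) simp
    qed
  qed (rule d(1))
qed


lemma bspline_mult_integrable_on:
  "(\<lambda>x. bspline t d k x * bspline u e l x) integrable_on {a..b}"
proof -
  obtain B B' where "\<forall>x\<in>{a..b}. \<bar>bspline t d k x\<bar> \<le> B" "\<forall>x\<in>{a..b}. \<bar>bspline u e l x\<bar> \<le> B'"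
    using bspline_bounded_Icc by metis
  then show ?thesis
    by (intro bounded_measurable_integrable_on[where B = "B * B'"])
      (auto simp: abs_mult intro!: mult_mono order_trans[OF abs_ge_zero])
qed

lemma mono_extend_knots:
  assumes "mono s" "a \<le> s 0" "s (N - 1) \<le> b"
  shows "mono (extend_knots a N s b)"
proof (rule monoI)
  fix i j :: nat
  assume ij: "i \<le> j"
  have "a \<le> s (j - 1)"
    using assms(2) monoD[OF assms(1), of 0 "j - 1"] by simp
  moreover have "s (i - 1) \<le> s (j - 1)"
    using ij by (intro monoD[OF assms(1)]) simp
  moreover have "s (i - 1) \<le> b" if "i \<le> N"
    using that by (intro order_trans[OF monoD[OF assms(1)] assms(3)]) simp
  moreover have "a \<le> b"
    using assms(2,3) monoD[OF assms(1), of 0 "N - 1"] by simp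
  ultimately show "extend_knots a N s b i \<le> extend_knots a N s b j"
    using ij by (auto simp: extend_knots_def)
qed

section \<open>B-spline coefficients of the squared curve and of its integral\<close>

theorem mainTheorem1:
  fixes n p q :: nat and t s :: "nat \<Rightarrow> real" and z :: "nat \<Rightarrow> complex"
    and A :: "real mat" and b :: "nat \<Rightarrow> nat \<Rightarrow> real Matrix.vec"
  assumes "n \<le> p"
    and "mono_on {..p + n + 1} t"
    and "q = (n + 1) * (p + n)"
    and "s = repeat_knots (n + 1) t"
    and "A = Matrix.mat (q + 1) (q + 1) (\<lambda>(k, l).
           integral {t 0..t (p + n + 1)} (\<lambda>x. bspline s (2 * n) k x * bspline s (2 * n) l x))"
    and "b = (\<lambda>i j. Matrix.vec (q + 1) (\<lambda>l.
           integral {t 0..t (p + n + 1)}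
             (\<lambda>x. bspline t n i x * bspline t n j x * bspline s (2 * n) l x)))"
  shows
    \<comment> \<open>(i) Independence, nonsingularity and uniqueness fail as soon as two knots of \<open>t\<close> coincide:
        some \<open>bspline s (2 * n) k\<close> is then built on \<open>2 * n + 2\<close> equal knots and vanishes.\<close>
    "(strict_mono_on {..p + n + 1} t \<longrightarrow>
        linearly_independent_on {t 0..t (p + n + 1)} {..q} (bspline s (2 * n))
        \<and> invertible_mat A
        \<and> (\<forall>i\<le>p. \<forall>j\<le>p. \<exists>!\<xi>. \<xi> \<in> carrier_vec (q + 1) \<and> A *\<^sub>v \<xi> = b i j))
     \<and>
     (\<forall>i\<le>p. \<forall>j\<le>p.
        (\<exists>\<xi>\<in>carrier_vec (q + 1). A *\<^sub>v \<xi> = b i j)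
        \<and> (\<forall>\<xi>\<in>carrier_vec (q + 1).
             A *\<^sub>v \<xi> = b i j \<longleftrightarrow>
             (\<forall>x. bspline t n i x * bspline t n j x
                  = (\<Sum>k\<le>q. vec_index \<xi> k * bspline s (2 * n) k x))))
     \<and>
     (\<forall>\<xi> P.
        (\<forall>i\<le>p. \<forall>j\<le>p. \<xi> i j \<in> carrier_vec (q + 1) \<and> A *\<^sub>v \<xi> i j = b i j)
        \<and> P = (\<lambda>k. \<Sum>i\<le>p. \<Sum>j\<le>p. vec_index (\<xi> i j) k *\<^sub>R (z i * z j)) \<longrightarrow>
        \<comment> \<open>(ii)\<close>
        (\<forall>x\<in>{t n..t (p + 1)}. (spline t n p z x)\<^sup>2 = spline s (2 * n) q P x)
        \<and>
        \<comment> \<open>(iii) \<open>D\<close> is the interval \<open>{t n..t (p + 1)}\<close>, except that its right end is left out if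
            \<open>t (p + 1), \<dots>, t (p + n + 1), t_post\<close> all coincide: B-splines being supported on
            half-open intervals, the sum would jump to \<open>0\<close> there.\<close>
        (\<forall>t_pre t_post \<rho> D.
           t_pre \<le> t 0 \<and> t (p + n + 1) \<le> t_post
           \<and> \<rho> = extend_knots t_pre ((p + n + 2) * (n + 1)) s t_post
           \<and> D = {x. t n \<le> x \<and> x \<le> t (p + 1) \<and> x < t_post} \<longrightarrow>
           (\<forall>R. (\<forall>i\<le>q. R (i + 1) = R i + ((s (i + 2 * n + 1) - s i) / real (2 * n + 1)) *\<^sub>R P i) \<longrightarrow>
              indefinite_integral_on D (spline s (2 * n) q P) (spline \<rho> (2 * n + 1) (q + 1) R)
              \<and> (\<forall>x\<in>D. continuous (at x within D) (spline t n p z) \<longrightarrow>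
                    (spline \<rho> (2 * n + 1) (q + 1) R has_vector_derivative (spline t n p z x)\<^sup>2)
                      (at x within D)))
           \<and>
           (\<forall>r. indefinite_integral_on D (spline s (2 * n) q P) r \<longrightarrow>
              (\<exists>R. (\<forall>i\<le>q. R (i + 1) = R i + ((s (i + 2 * n + 1) - s i) / real (2 * n + 1)) *\<^sub>R P i)
                   \<and> (\<forall>x\<in>D. r x = spline \<rho> (2 * n + 1) (q + 1) R x)))))"
proof -
  \<comment> \<open>\<open>L\<close> is the index of the last original knot, and \<open>N\<close> is
    the number of repeated knots.\<close>
  define L where "L = p + n + 1"
  define N where "N = q + 2 * n + 2"
  \<comment> \<open>The values of \<open>t\<close> beyond \<open>L\<close> are arbitrary; make the sequence monotone everywhere.\<close>
  define t' where "t' i = t (min i L)" for i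
  define s' where "s' = repeat_knots (n + 1) t'"
  have N: "N = (L + 1) * (n + 1)"
    unfolding N_def L_def assms(3) by (simp add: algebra_simps)
  have mono_t': "mono t'"
    unfolding t'_def using assms(2) by (intro monoI) (auto simp: L_def intro!: mono_onD[of _ t])
  have mono_s': "mono s'"
    unfolding s'_def using mono_t' by (rule mono_repeat_knots)
  have t': "t' i = t i" if "i \<le> L" for i
    using that by (simp add: t'_def)
  have div_le: "i div (n + 1) \<le> L \<longleftrightarrow> i < N" for i
    unfolding N using div_less_iff_less_mult[of "n + 1" i "L + 1"] by (simp add: less_Suc_eq_le)
  have s': "s' i = s i" if "i < N" for i
    using that t' unfolding div_le[symmetric] by (simp add: s'_def assms(4) repeat_knots_def)
  have s'_0: "s' 0 = t 0"
    using t'[of 0] by (simp add: s'_def repeat_knots_def)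
  have "(N - 1) div (n + 1) = L"
    unfolding N by (rule div_nat_eqI) (simp_all add: algebra_simps)
  then have s'_last: "s' (N - 1) = t L"
    using t'[of L] by (simp add: s'_def repeat_knots_def)
  then have s'_last': "s' (q + 2 * n + 1) = t L"
    by (simp add: N_def)
  have bt: "bspline t n i x = bspline t' n i x" if "i \<le> p" for i x
    using that by (intro bspline_cong) (simp add: t' L_def)
  have bs: "bspline s (2 * n) k x = bspline s' (2 * n) k x" if "k \<le> q" for k x
    using that by (intro bspline_cong) (simp add: s' N_def)
  have supp: "bspline s (2 * n) k x = 0" if "k \<le> q" "x < t 0 \<or> t L \<le> x" for k x
    unfolding bs[OF that(1)] using that monoD[OF mono_s', of 0 k] monoD[OF mono_s', of "k + Suc (2 * n)" "q + 2 * n + 1"]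
    unfolding s'_0 s'_last' by (intro bspline_eq_0[OF mono_s']) auto
  have A: "A = Matrix.mat (q + 1) (q + 1) (\<lambda>(k, l).
      integral {t 0..t L} (\<lambda>x. bspline s (2 * n) k x * bspline s (2 * n) l x))"
    using assms(5) by (simp add: L_def)
  \<comment> \<open>The assumptions of the Gramian context, in their order.\<close>
  note gram = bspline_continuous_at_right[of _ s "2 * n"]
    bspline_mult_integrable_on[of s "2 * n" _ s "2 * n" _ "t 0" "t L"] supp A
  have expansion: "\<exists>c. \<forall>x. bspline t n i x * bspline t n j x = (\<Sum>k\<le>q. c k * bspline s (2 * n) k x)"
    if "i \<le> p" "j \<le> p" for i j
  proof -
    have "\<exists>c. \<forall>x. bspline t' n i x * bspline t' n j x = (\<Sum>k\<le>q. c k * bspline s' (2 * n) k x)"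
      using that N by (intro bspline_mult_expansion[OF mono_t' s'_def, of L]) (simp_all add: L_def N_def)
    then show ?thesis
      using that by (simp add: bt bs)
  qed
  have system: "\<exists>\<xi>\<in>carrier_vec (q + 1). A *\<^sub>v \<xi> = b i j"
    "\<forall>\<xi>\<in>carrier_vec (q + 1). A *\<^sub>v \<xi> = b i j \<longleftrightarrow>
      (\<forall>x. bspline t n i x * bspline t n j x = (\<Sum>k\<le>q. vec_index \<xi> k * bspline s (2 * n) k x))"
    if ij: "i \<le> p" "j \<le> p" for i j
  proof -
    obtain c where c: "bspline t n i x * bspline t n j x = (\<Sum>k\<le>q. c k * bspline s (2 * n) k x)" for x
      using expansion[OF ij] by blast
    have b: "b i j = Matrix.vec (q + 1) (\<lambda>l.
        integral {t 0..t L} (\<lambda>x. (bspline t n i x * bspline t n j x) * bspline s (2 * n) l x))"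
      using assms(6) by (simp add: L_def)
    show "\<exists>\<xi>\<in>carrier_vec (q + 1). A *\<^sub>v \<xi> = b i j"
      by (rule gram_system(1)[OF gram c b])
    show "\<forall>\<xi>\<in>carrier_vec (q + 1). A *\<^sub>v \<xi> = b i j \<longleftrightarrow>
      (\<forall>x. bspline t n i x * bspline t n j x = (\<Sum>k\<le>q. vec_index \<xi> k * bspline s (2 * n) k x))"
      by (intro ballI gram_system(2)[OF gram c b])
  qed
  have independent: "linearly_independent_on {t 0..t L} {..q} (bspline s (2 * n))"
    if strict: "strict_mono_on {..L} t"
    unfolding linearly_independent_on_def
  proof (intro allI impI ballI)
    fix c k
    assume c: "\<forall>x\<in>{t 0..t L}. (\<Sum>k\<in>{..q}. c k * bspline s (2 * n) k x) = 0" and k: "k \<in> {..q}"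
    define m where "m = k div (n + 1)"
    \<comment> \<open>The last copy of \<open>t m\<close>: the interval from \<open>s' j\<close> to
      \<open>s' (Suc j)\<close> is then nonempty, and it meets the support of the B-spline
      \<open>k\<close>, which starts at some copy of \<open>t m\<close>.\<close>
    define j where "j = (n + 1) * m + n"
    \<comment> \<open>\<open>j\<close> may exceed \<open>q\<close>, so the coefficients are
      continued by 0.\<close>
    define c' where "c' i = (if i \<le> q then c i else 0)" for i
    have "k = (n + 1) * m + k mod (n + 1)" "k mod (n + 1) < n + 1"
      unfolding m_def by (simp_all only: mult_div_mod_eq) simp
    then have kj: "k \<le> j" "j \<le> k + 2 * n"
      unfolding j_def by linarith+
    have m: "m + 1 \<le> L"
    proof -
      have "m \<le> p + n"
        using k div_le_mono[of k q "n + 1"] nonzero_mult_div_cancel_left[of "n + 1" "p + n"]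
        unfolding m_def assms(3) by (simp del: mult_Suc)
      then show ?thesis
        by (simp add: L_def)
    qed
    have "j div (n + 1) = m" "Suc j div (n + 1) = m + 1"
      unfolding j_def by (rule div_nat_eqI; simp add: algebra_simps)+
    then have sj: "s' j = t m" "s' (Suc j) = t (m + 1)"
      using m t' by (simp_all add: s'_def repeat_knots_def)
    have "c' k = 0"
    proof (rule bspline_local_independent[OF mono_s' _ _ kj])
      show "s' j < s' (Suc j)"
        unfolding sj using m by (intro strict_mono_onD[OF strict]) auto
      fix x assume x: "s' j < x" "x < s' (Suc j)"
      \<comment> \<open>The range up to \<open>j + q\<close> contains both index sets: beyond
        \<open>j\<close> the B-splines start to the right of \<open>x\<close>, beyond
        \<open>q\<close> the coefficients are 0.\<close>
      have "(\<Sum>i\<le>j. c' i * bspline s' (2 * n) i x) = (\<Sum>i\<le>j + q. c' i * bspline s' (2 * n) i x)"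
      proof (rule sum.mono_neutral_left)
        show "\<forall>i\<in>{..j + q} - {..j}. c' i * bspline s' (2 * n) i x = 0"
        proof
          fix i assume "i \<in> {..j + q} - {..j}"
          then have "x < s' i"
            using x(2) monoD[OF mono_s', of "Suc j" i] by auto
          then show "c' i * bspline s' (2 * n) i x = 0"
            using bspline_eq_0[OF mono_s'] by simp
        qed
      qed auto
      also have "\<dots> = (\<Sum>i\<le>q. c i * bspline s (2 * n) i x)"
        by (rule sum.mono_neutral_cong_right) (auto simp: c'_def bs)
      also have "\<dots> = 0"
        using c x sj monoD[OF mono_t', of 0 m] monoD[OF mono_t', of "m + 1" L] m t' by auto
      finally show "(\<Sum>i\<le>j. c' i * bspline s' (2 * n) i x) = 0" .
    qed
    then show "c k = 0"
      using k by (simp add: c'_def)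
  qed
  have unique: "\<exists>!\<xi>. \<xi> \<in> carrier_vec (q + 1) \<and> A *\<^sub>v \<xi> = b i j"
    if strict: "strict_mono_on {..L} t" and ij: "i \<le> p" "j \<le> p" for i j
  proof (rule ex_ex1I)
    show "\<exists>\<xi>. \<xi> \<in> carrier_vec (q + 1) \<and> A *\<^sub>v \<xi> = b i j"
      using system(1)[OF ij] by blast
    fix \<xi> \<eta>
    assume \<xi>: "\<xi> \<in> carrier_vec (q + 1) \<and> A *\<^sub>v \<xi> = b i j" and \<eta>: "\<eta> \<in> carrier_vec (q + 1) \<and> A *\<^sub>v \<eta> = b i j"
    have "bspline t n i x * bspline t n j x = (\<Sum>k\<le>q. vec_index \<xi> k * bspline s (2 * n) k x)" for x
      using system(2)[OF ij] \<xi> by blast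
    moreover have "bspline t n i x * bspline t n j x = (\<Sum>k\<le>q. vec_index \<eta> k * bspline s (2 * n) k x)" for x
      using system(2)[OF ij] \<eta> by blast
    ultimately have "(\<Sum>k\<le>q. vec_index \<xi> k * bspline s (2 * n) k x) = (\<Sum>k\<le>q. vec_index \<eta> k * bspline s (2 * n) k x)" for x
      by simp
    then have "(\<Sum>k\<in>{..q}. (vec_index \<xi> k - vec_index \<eta> k) * bspline s (2 * n) k x) = 0" for x
      by (simp add: left_diff_distrib sum_subtractf)
    then have "\<forall>k\<in>{..q}. vec_index \<xi> k - vec_index \<eta> k = 0"
      using spec[OF independent[OF strict, unfolded linearly_independent_on_def],
        of "\<lambda>k. vec_index \<xi> k - vec_index \<eta> k"] by blast
    then show "\<xi> = \<eta>"
      using \<xi> \<eta> by (intro eq_vecI) auto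
  qed
  have part1: "strict_mono_on {..p + n + 1} t \<longrightarrow>
        linearly_independent_on {t 0..t (p + n + 1)} {..q} (bspline s (2 * n))
        \<and> invertible_mat A
        \<and> (\<forall>i\<le>p. \<forall>j\<le>p. \<exists>!\<xi>. \<xi> \<in> carrier_vec (q + 1) \<and> A *\<^sub>v \<xi> = b i j)"
  proof (intro impI)
    assume "strict_mono_on {..p + n + 1} t"
    then have strict: "strict_mono_on {..L} t"
      by (simp add: L_def)
    show "linearly_independent_on {t 0..t (p + n + 1)} {..q} (bspline s (2 * n))
        \<and> invertible_mat A
        \<and> (\<forall>i\<le>p. \<forall>j\<le>p. \<exists>!\<xi>. \<xi> \<in> carrier_vec (q + 1) \<and> A *\<^sub>v \<xi> = b i j)"
      using independent[OF strict] gram_invertible[OF gram independent[OF strict]] unique[OF strict]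
      by (simp only: L_def) simp
  qed
  have square: "(spline t n p z x)\<^sup>2 = spline s (2 * n) q P x"
    if \<xi>: "\<forall>i\<le>p. \<forall>j\<le>p. \<xi> i j \<in> carrier_vec (q + 1) \<and> A *\<^sub>v \<xi> i j = b i j"
      and P: "P = (\<lambda>k. \<Sum>i\<le>p. \<Sum>j\<le>p. vec_index (\<xi> i j) k *\<^sub>R (z i * z j))" for \<xi> P x
  proof -
    have "(spline t n p z x)\<^sup>2 = (\<Sum>i\<le>p. \<Sum>j\<le>p. (bspline t n i x * bspline t n j x) *\<^sub>R (z i * z j))"
      by (simp add: spline_def power2_eq_square sum_product mult.commute)
    also have "\<dots> = (\<Sum>i\<le>p. \<Sum>j\<le>p. \<Sum>k\<le>q. bspline s (2 * n) k x *\<^sub>R (vec_index (\<xi> i j) k *\<^sub>R (z i * z j)))"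
    proof (intro sum.cong refl)
      fix i j assume "i \<in> {..p}" "j \<in> {..p}"
      then have "bspline t n i x * bspline t n j x = (\<Sum>k\<le>q. vec_index (\<xi> i j) k * bspline s (2 * n) k x)"
        using system(2)[of i j] \<xi> by auto
      then show "(bspline t n i x * bspline t n j x) *\<^sub>R (z i * z j)
          = (\<Sum>k\<le>q. bspline s (2 * n) k x *\<^sub>R (vec_index (\<xi> i j) k *\<^sub>R (z i * z j)))"
        by (simp add: scaleR_sum_left mult.commute)
    qed
    also have "\<dots> = (\<Sum>i\<le>p. \<Sum>k\<le>q. \<Sum>j\<le>p. bspline s (2 * n) k x *\<^sub>R (vec_index (\<xi> i j) k *\<^sub>R (z i * z j)))"
      by (intro sum.cong refl sum.swap)
    also have "\<dots> = (\<Sum>k\<le>q. \<Sum>i\<le>p. \<Sum>j\<le>p. bspline s (2 * n) k x *\<^sub>R (vec_index (\<xi> i j) k *\<^sub>R (z i * z j)))"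
      by (rule sum.swap)
    also have "\<dots> = spline s (2 * n) q P x"
      by (simp add: spline_def P scaleR_sum_right)
    finally show ?thesis .
  qed
  have integral: "(\<forall>R. (\<forall>i\<le>q. R (i + 1) = R i + ((s (i + 2 * n + 1) - s i) / real (2 * n + 1)) *\<^sub>R P i) \<longrightarrow>
              indefinite_integral_on D (spline s (2 * n) q P) (spline \<rho> (2 * n + 1) (q + 1) R))
           \<and> (\<forall>r. indefinite_integral_on D (spline s (2 * n) q P) r \<longrightarrow>
              (\<exists>R. (\<forall>i\<le>q. R (i + 1) = R i + ((s (i + 2 * n + 1) - s i) / real (2 * n + 1)) *\<^sub>R P i)
                   \<and> (\<forall>x\<in>D. r x = spline \<rho> (2 * n + 1) (q + 1) R x)))"
    if pre: "t_pre \<le> t 0" and post: "t L \<le> t_post"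
      and \<rho>: "\<rho> = extend_knots t_pre N s t_post"
      and D: "D = {x. t n \<le> x \<and> x \<le> t (p + 1) \<and> x < t_post}" for t_pre t_post \<rho> D and P :: "nat \<Rightarrow> complex"
  proof -
    have \<rho>': "\<rho> = extend_knots t_pre N s' t_post"
      unfolding \<rho> extend_knots_def using s' by (auto simp: fun_eq_iff)
    have mono_\<rho>: "mono \<rho>"
      unfolding \<rho>' by (intro mono_extend_knots mono_s') (simp_all only: s'_0 s'_last pre post)
    have \<rho>_Suc: "\<rho> (Suc i) = s i" if "i < N" for i
      using that by (simp add: \<rho> extend_knots_def)
    have D': "\<rho> (Suc (2 * n)) \<le> x \<and> x \<le> \<rho> (Suc (q + 1)) \<and> x < \<rho> (Suc (q + 1) + Suc (2 * n))"
      if "x \<in> D" for x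
    proof -
      \<comment> \<open>After the shift by one, \<open>\<rho> (Suc (2 * n))\<close> is
        \<open>s (2 * n)\<close>, a copy of a knot with index at most \<open>n\<close>; hence the
        first step is 1 on \<open>D\<close>.\<close>
      have "2 * n div (n + 1) < n + 1"
        by (subst div_less_iff_less_mult) (simp_all add: algebra_simps)
      then have "t' (2 * n div (n + 1)) \<le> t n"
        using monoD[OF mono_t', of "2 * n div (n + 1)" n] t'[of n] by (simp add: L_def)
      then have 1: "\<rho> (Suc (2 * n)) \<le> t n"
        using \<rho>_Suc[of "2 * n"] s'[of "2 * n"] by (simp add: N_def s'_def repeat_knots_def)
      \<comment> \<open>An equality for \<open>n = 0\<close>. It places the knot
        \<open>\<rho> (Suc (q + 1))\<close>, where the last step starts to rise, at or behind
        \<open>t (p + 1)\<close>.\<close>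
      have "(p + 1) * (n + 1) \<le> q + 1"
        unfolding assms(3) by (cases n) (simp_all add: algebra_simps)
      then have "p + 1 \<le> (q + 1) div (n + 1)"
        by (subst less_eq_div_iff_mult_less_eq) simp_all
      then have "t (p + 1) \<le> t' ((q + 1) div (n + 1))"
        using monoD[OF mono_t', of "p + 1" "(q + 1) div (n + 1)"] t'[of "p + 1"] by (simp add: L_def)
      then have 2: "t (p + 1) \<le> \<rho> (Suc (q + 1))"
        using \<rho>_Suc[of "q + 1"] s'[of "q + 1"] by (simp add: N_def s'_def repeat_knots_def)
      have 3: "\<rho> (Suc (q + 1) + Suc (2 * n)) = t_post"
        by (simp add: \<rho> extend_knots_def N_def)
      show ?thesis
        using that 1 2 unfolding 3 D by auto
    qed
    have spline_s: "(\<lambda>x. \<Sum>k<q + 1. bspline \<rho> (2 * n) (Suc k) x *\<^sub>R P k) = spline s (2 * n) q P"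
    proof
      fix x
      have "bspline \<rho> (2 * n) (Suc k) x = bspline s (2 * n) k x" if "k \<le> q" for k
        using that \<rho>_Suc by (intro bspline_cong) (simp add: N_def)
      then show "(\<Sum>k<q + 1. bspline \<rho> (2 * n) (Suc k) x *\<^sub>R P k) = spline s (2 * n) q P x"
        by (simp add: spline_def lessThan_Suc_atMost del: sum.lessThan_Suc)
    qed
    have F: "indefinite_integral_on D (spline s (2 * n) q P) (spline \<rho> (2 * n + 1) (q + 1) R)"
      if R: "\<forall>i\<le>q. R (i + 1) = R i + ((s (i + 2 * n + 1) - s i) / real (2 * n + 1)) *\<^sub>R P i" for R
    proof -
      have step: "R (Suc k) = R k + ((\<rho> (Suc k + Suc (2 * n)) - \<rho> (Suc k)) / real (Suc (2 * n))) *\<^sub>R P k"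
        if "k < q + 1" for k
        using that R \<rho>_Suc[of k] \<rho>_Suc[of "k + 2 * n + 1"] by (simp add: N_def)
      have "indefinite_integral_on D (\<lambda>x. \<Sum>k<q + 1. bspline \<rho> (2 * n) (Suc k) x *\<^sub>R P k)
          (spline \<rho> (Suc (2 * n)) (q + 1) R)"
        by (rule spline_indefinite_integral[OF mono_\<rho>], erule D', erule step)
      then show ?thesis
        unfolding spline_s by simp
    qed
    have "\<exists>R. (\<forall>i\<le>q. R (i + 1) = R i + ((s (i + 2 * n + 1) - s i) / real (2 * n + 1)) *\<^sub>R P i)
        \<and> (\<forall>x\<in>D. r x = spline \<rho> (2 * n + 1) (q + 1) R x)"
      if r: "indefinite_integral_on D (spline s (2 * n) q P) r" for r
    proof -
      \<comment> \<open>The solution of the recurrence with initial value \<open>c\<close>. By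
        \<open>spline_sum_by_parts\<close>, changing \<open>c\<close> translates the curve, and two
        integrals of the same function differ by a constant.\<close>
      define R where "R c i = c + (\<Sum>k<i. ((s (k + 2 * n + 1) - s k) / real (2 * n + 1)) *\<^sub>R P k)" for c i
      have R: "\<forall>i\<le>q. R c (i + 1) = R c i + ((s (i + 2 * n + 1) - s i) / real (2 * n + 1)) *\<^sub>R P i" for c
        by (simp add: R_def)
      define F0 where "F0 = spline \<rho> (2 * n + 1) (q + 1) (R 0)"
      \<comment> \<open>Matches the two integrals at the left end, which belongs to \<open>D\<close>
        as soon as \<open>D\<close> has any point.\<close>
      define c where "c = r (t n) - F0 (t n)"
      have "r x = spline \<rho> (2 * n + 1) (q + 1) (R c) x" if x: "x \<in> D" for x
      proof -
        have x0: "t n \<in> D" "t n \<le> x"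
          using x unfolding D by auto
        have "r x - r (t n) = F0 x - F0 (t n)"
          using r F[OF R[of 0]] x x0 unfolding indefinite_integral_on_def F0_def
          by (blast intro: has_integral_unique)
        moreover have "spline \<rho> (2 * n + 1) (q + 1) (R c) x = c + F0 x"
          using spline_sum_by_parts[OF mono_\<rho>, of "Suc (2 * n)" x "q + 1"] D'[OF x]
          by (simp add: F0_def R_def del: sum.lessThan_Suc)
        ultimately show ?thesis
          by (simp add: c_def diff_eq_eq)
      qed
      then show ?thesis
        using R by blast
    qed
    then show ?thesis
      using F by blast
  qed
  have part3: "\<forall>t_pre t_post \<rho> D.
           t_pre \<le> t 0 \<and> t (p + n + 1) \<le> t_post
           \<and> \<rho> = extend_knots t_pre ((p + n + 2) * (n + 1)) s t_post
           \<and> D = {x. t n \<le> x \<and> x \<le> t (p + 1) \<and> x < t_post} \<longrightarrow>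
           (\<forall>R. (\<forall>i\<le>q. R (i + 1) = R i + ((s (i + 2 * n + 1) - s i) / real (2 * n + 1)) *\<^sub>R P i) \<longrightarrow>
              indefinite_integral_on D (spline s (2 * n) q P) (spline \<rho> (2 * n + 1) (q + 1) R)
              \<and> (\<forall>x\<in>D. continuous (at x within D) (spline t n p z) \<longrightarrow>
                    (spline \<rho> (2 * n + 1) (q + 1) R has_vector_derivative (spline t n p z x)\<^sup>2)
                      (at x within D)))
           \<and>
           (\<forall>r. indefinite_integral_on D (spline s (2 * n) q P) r \<longrightarrow>
              (\<exists>R. (\<forall>i\<le>q. R (i + 1) = R i + ((s (i + 2 * n + 1) - s i) / real (2 * n + 1)) *\<^sub>R P i)
                   \<and> (\<forall>x\<in>D. r x = spline \<rho> (2 * n + 1) (q + 1) R x)))"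
    if sq: "\<And>x. (spline t n p z x)\<^sup>2 = spline s (2 * n) q P x" for P
  proof (intro allI impI conjI ballI; (elim conjE)?)
    fix t_pre t_post \<rho> D
    assume "t_pre \<le> t 0" "t (p + n + 1) \<le> t_post"
      and \<rho>: "\<rho> = extend_knots t_pre ((p + n + 2) * (n + 1)) s t_post"
      and D: "D = {x. t n \<le> x \<and> x \<le> t (p + 1) \<and> x < t_post}"
    moreover have "(p + n + 2) * (n + 1) = N"
      by (simp add: N L_def)
    ultimately have I: "(\<forall>R. (\<forall>i\<le>q. R (i + 1) = R i + ((s (i + 2 * n + 1) - s i) / real (2 * n + 1)) *\<^sub>R P i) \<longrightarrow>
              indefinite_integral_on D (spline s (2 * n) q P) (spline \<rho> (2 * n + 1) (q + 1) R))
           \<and> (\<forall>r. indefinite_integral_on D (spline s (2 * n) q P) r \<longrightarrow>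
              (\<exists>R. (\<forall>i\<le>q. R (i + 1) = R i + ((s (i + 2 * n + 1) - s i) / real (2 * n + 1)) *\<^sub>R P i)
                   \<and> (\<forall>x\<in>D. r x = spline \<rho> (2 * n + 1) (q + 1) R x)))"
      by (intro integral[where t_pre = t_pre and t_post = t_post]) (simp_all add: L_def)
    {
      fix R assume R: "\<forall>i\<le>q. R (i + 1) = R i + ((s (i + 2 * n + 1) - s i) / real (2 * n + 1)) *\<^sub>R P i"
      show F: "indefinite_integral_on D (spline s (2 * n) q P) (spline \<rho> (2 * n + 1) (q + 1) R)"
        using I R by blast
      fix x assume x: "x \<in> D" and cont: "continuous (at x within D) (spline t n p z)"
      have "is_interval D"
        unfolding D is_interval_1 by auto
      \<comment> \<open>The square identity holds on the whole line, so continuity passes from the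
        given spline to its expansion over the repeated knots.\<close>
      moreover have "continuous (at x within D) (spline s (2 * n) q P)"
        using continuous_power[OF cont, of 2] by (simp add: sq)
      ultimately show "(spline \<rho> (2 * n + 1) (q + 1) R has_vector_derivative (spline t n p z x)\<^sup>2) (at x within D)"
        unfolding sq using indefinite_integral_has_vector_derivative[OF F _ x] by blast
    }
    show "\<exists>R. (\<forall>i\<le>q. R (i + 1) = R i + ((s (i + 2 * n + 1) - s i) / real (2 * n + 1)) *\<^sub>R P i)
          \<and> (\<forall>x\<in>D. r x = spline \<rho> (2 * n + 1) (q + 1) R x)"
      if "indefinite_integral_on D (spline s (2 * n) q P) r" for r
      using I that by blast
  qed
  show ?thesis
  proof (rule conjI[OF part1], rule conjI)
    show "\<forall>i\<le>p. \<forall>j\<le>p.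
        (\<exists>\<xi>\<in>carrier_vec (q + 1). A *\<^sub>v \<xi> = b i j)
        \<and> (\<forall>\<xi>\<in>carrier_vec (q + 1).
             A *\<^sub>v \<xi> = b i j \<longleftrightarrow>
             (\<forall>x. bspline t n i x * bspline t n j x
                  = (\<Sum>k\<le>q. vec_index \<xi> k * bspline s (2 * n) k x)))"
      using system by blast
  qed (intro allI impI, elim conjE, rule conjI, (intro ballI)?, erule (1) square, rule part3, erule (1) square)
qed

end
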